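(* Let $\mathcal{C}$ be a congruence-modular equational class, let $M,N$ be members of $\mathcal{C}$, let $h:M\to N$ be a morphism in $\mathcal{C}$, and let $i:h(M)\to N$ be the canonical embedding of the subalgebra $h(M)$ of $N$ into $N$. Then: (1) $h$ is admissible iff $i$ is admissible; (2) if $h$ is admissible, then: $h$ fulfills GU iff $i$ fulfills GU; (3) if $h$ is admissible, then: $h$ fulfills LO iff $i$ fulfills LO.
   Context: An equational class (variety) $\mathcal{C}$ of algebras of a fixed type is congruence-modular if the congruence lattice $\mathrm{Con}(M)$ is modular for every member $M$ of $\mathcal{C}$. All algebras are non-empty; a morphism in $\mathcal{C}$ is a homomorphism between members of $\mathcal{C}$. For an algebra $M$, $\Delta_M$ is the equality relation and $\nabla_M=M^2$. In a congruence-modular class, the commutator $[\alpha,\beta]_M$ of $\alpha,\beta\in\mathrm{Con}(M)$ is the (Freese--McKenzie) modular commutator, i.e. the smallest congruence $\delta$ of $M$ such that, for every term $t(\bar x,\bar y)$ and all tuples $\bar a,\bar b,\bar c,\bar d$ of elements of $M$ with $(a_i,b_i)\in\alpha$ for all $i$ and $(c_j,d_j)\in\beta$ for all $j$, $(t(\bar a,\bar c),t(\bar a,\bar d))\in\delta$ implies $(t(\bar b,\bar c),t(\bar b,\bar d))\in\delta$. A congruence $\phi\neq\nabla_M$ is prime if, for all $\alpha,\beta\in\mathrm{Con}(M)$, $[\alpha,\beta]_M\subseteq\phi$ implies $\alpha\subseteq\phi$ or $\beta\subseteq\phi$; $\mathrm{Spec}(M)$ is the set of prime congruences of $M$. For a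 morphism $f:A\to B$ and $\psi\in\mathrm{Con}(B)$, $f^*(\psi)=\{(x,y)\in A^2 : (f(x),f(y))\in\psi\}\in\mathrm{Con}(A)$ and $\mathrm{Ker}(f)=f^*(\Delta_B)$. $f$ is admissible if $f^*(\psi)\in\mathrm{Spec}(A)$ for all $\psi\in\mathrm{Spec}(B)$. An admissible morphism $f:A\to B$ fulfills GU (Going Up) if for all $\phi,\psi\in\mathrm{Spec}(A)$ and $\phi_1\in\mathrm{Spec}(B)$ with $\phi\subseteq\psi$ and $f^*(\phi_1)=\phi$ there is $\psi_1\in\mathrm{Spec}(B)$ with $\phi_1\subseteq\psi_1$ and $f^*(\psi_1)=\psi$; it fulfills LO (Lying Over) if for every $\phi\in\mathrm{Spec}(A)$ with $\mathrm{Ker}(f)\subseteq\phi$ there is $\phi_1\in\mathrm{Spec}(B)$ with $f^*(\phi_1)=\phi$. *)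

theory Defs
  imports "HOL-Algebra.Lattice"
begin

section \<open>Algebras, terms and equational classes\<close>

text \<open>The operation symbols form a set, rather than a whole type, so that the empty
  signature is not excluded.\<close>

record 'f signature =
  symbols :: "'f set"
  arity :: "'f \<Rightarrow> nat"

record ('f, 'a) algebra = "'a partial_object" +
  oper :: "'f \<Rightarrow> 'a list \<Rightarrow> 'a"

definition is_algebra :: "'f signature \<Rightarrow> ('f, 'a) algebra \<Rightarrow> bool" where
  "is_algebra S M \<longleftrightarrow> carrier M \<noteq> {} \<and>
     (\<forall>f\<in>symbols S. \<forall>xs. length xs = arity S f \<and> set xs \<subseteq> carrier M \<longrightarrow> oper M f xs \<in> carrier M)"

datatype ('f, 'v) trm = Var 'v | App 'f "('f, 'v) trm list"

fun wf_trm :: "'f signature \<Rightarrow> ('f, 'v) trm \<Rightarrow> bool" where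
  "wf_trm S (Var x) \<longleftrightarrow> True"
| "wf_trm S (App f ts) \<longleftrightarrow> f \<in> symbols S \<and> length ts = arity S f \<and> (\<forall>t\<in>set ts. wf_trm S t)"

fun eval_trm :: "('f, 'a) algebra \<Rightarrow> ('v \<Rightarrow> 'a) \<Rightarrow> ('f, 'v) trm \<Rightarrow> 'a" where
  "eval_trm M \<sigma> (Var x) = \<sigma> x"
| "eval_trm M \<sigma> (App f ts) = oper M f (map (eval_trm M \<sigma>) ts)"

definition wf_identities :: "'f signature \<Rightarrow> (('f, nat) trm \<times> ('f, nat) trm) set \<Rightarrow> bool" where
  "wf_identities S E \<longleftrightarrow> (\<forall>(s, t)\<in>E. wf_trm S s \<and> wf_trm S t)"

definition equational_class ::
    "'f signature \<Rightarrow> (('f, nat) trm \<times> ('f, nat) trm) set \<Rightarrow> ('f, 'a) algebra set" where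
  "equational_class S E = {M. is_algebra S M \<and>
     (\<forall>(s, t)\<in>E. \<forall>\<sigma>. range \<sigma> \<subseteq> carrier M \<longrightarrow> eval_trm M \<sigma> s = eval_trm M \<sigma> t)}"

definition morphism :: "'f signature \<Rightarrow> ('f, 'a) algebra \<Rightarrow> ('f, 'b) algebra \<Rightarrow> ('a \<Rightarrow> 'b) \<Rightarrow> bool" where
  "morphism S M N h \<longleftrightarrow> h ` carrier M \<subseteq> carrier N \<and>
     (\<forall>f\<in>symbols S. \<forall>xs. length xs = arity S f \<and> set xs \<subseteq> carrier M \<longrightarrow>
        h (oper M f xs) = oper N f (map h xs))"

definition image_algebra :: "('f, 'a) algebra \<Rightarrow> ('f, 'b) algebra \<Rightarrow> ('a \<Rightarrow> 'b) \<Rightarrow> ('f, 'b) algebra" where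
  "image_algebra M N h = N\<lparr>carrier := h ` carrier M\<rparr>"


section \<open>Congruences and congruence-modularity\<close>

definition Con :: "'f signature \<Rightarrow> ('f, 'a) algebra \<Rightarrow> ('a \<times> 'a) set set" where
  "Con S M = {\<theta>. equiv (carrier M) \<theta> \<and>
     (\<forall>f\<in>symbols S. \<forall>xs ys. length xs = arity S f \<and> list_all2 (\<lambda>x y. (x, y) \<in> \<theta>) xs ys \<longrightarrow>
        (oper M f xs, oper M f ys) \<in> \<theta>)}"

definition con_lattice :: "'f signature \<Rightarrow> ('f, 'a) algebra \<Rightarrow> ('a \<times> 'a) set gorder" where
  "con_lattice S M = \<lparr>carrier = Con S M, eq = (=), le = (\<subseteq>)\<rparr>"

definition modular_lattice :: "'a gorder \<Rightarrow> bool" where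
  "modular_lattice L \<longleftrightarrow> lattice L \<and>
     (\<forall>x\<in>carrier L. \<forall>y\<in>carrier L. \<forall>z\<in>carrier L.
        x \<sqsubseteq>\<^bsub>L\<^esub> z \<longrightarrow> x \<squnion>\<^bsub>L\<^esub> (y \<sqinter>\<^bsub>L\<^esub> z) = (x \<squnion>\<^bsub>L\<^esub> y) \<sqinter>\<^bsub>L\<^esub> z)"

text \<open>HOL cannot quantify over all carrier types inside a formula, so the members of the class are
  those with carrier contained in a type \<open>'u\<close> passed as a parameter. If the terms over \<open>nat\<close> embed
  into \<open>'u\<close>, this loses nothing: \<open>'u\<close> then carries a copy of every countably generated free algebra
  of the class, and modularity of the congruence lattice of the one on four generators yields Day
  terms, hence modularity for members of any size.\<close>

definition congruence_modular ::
    "'u itself \<Rightarrow> 'f signature \<Rightarrow> (('f, nat) trm \<times> ('f, nat) trm) set \<Rightarrow> bool" where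
  "congruence_modular _ S E \<longleftrightarrow>
     (\<forall>M :: ('f, 'u) algebra. M \<in> equational_class S E \<longrightarrow> modular_lattice (con_lattice S M))"


section \<open>The modular commutator and prime congruences\<close>

text \<open>In a term \<open>t(x, y)\<close>, the variables \<open>Inl i\<close> are the \<open>x\<close>'s and the variables \<open>Inr j\<close> are the \<open>y\<close>'s.
  The tuples are infinite sequences; as \<open>t\<close> contains finitely many variables and congruences are
  reflexive on a non-empty carrier, this is the same as using finite tuples.\<close>

definition term_condition ::
    "'f signature \<Rightarrow> ('f, 'a) algebra \<Rightarrow> ('a \<times> 'a) set \<Rightarrow> ('a \<times> 'a) set \<Rightarrow> ('a \<times> 'a) set \<Rightarrow> bool" where
  "term_condition S M \<alpha> \<beta> \<delta> \<longleftrightarrow>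
     (\<forall>(t :: ('f, nat + nat) trm) (a :: nat \<Rightarrow> 'a) b c d.
        wf_trm S t \<and> (\<forall>i. (a i, b i) \<in> \<alpha>) \<and> (\<forall>j. (c j, d j) \<in> \<beta>) \<and>
        (eval_trm M (case_sum a c) t, eval_trm M (case_sum a d) t) \<in> \<delta> \<longrightarrow>
        (eval_trm M (case_sum b c) t, eval_trm M (case_sum b d) t) \<in> \<delta>)"

definition commutator ::
    "'f signature \<Rightarrow> ('f, 'a) algebra \<Rightarrow> ('a \<times> 'a) set \<Rightarrow> ('a \<times> 'a) set \<Rightarrow> ('a \<times> 'a) set" where
  "commutator S M \<alpha> \<beta> = \<Inter>{\<delta> \<in> Con S M. term_condition S M \<alpha> \<beta> \<delta>}"

lemma eval_trm_closed:
  assumes "is_algebra S M" "wf_trm S t" "range \<sigma> \<subseteq> carrier M"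
  shows "eval_trm M \<sigma> t \<in> carrier M"
  using assms(2)
proof (induction t)
  case (Var x)
  then show ?case using assms(3) by auto
next
  case (App f ts)
  then have "set (map (eval_trm M \<sigma>) ts) \<subseteq> carrier M" by auto
  then show ?case using App.prems assms(1) by (simp add: is_algebra_def)
qed

lemma full_in_Con:
  assumes "is_algebra S M"
  shows "carrier M \<times> carrier M \<in> Con S M"
proof -
  have *: "set xs \<subseteq> carrier M \<and> set ys \<subseteq> carrier M \<and> length ys = length xs"
    if "list_all2 (\<lambda>x y. (x, y) \<in> carrier M \<times> carrier M) xs ys" for xs ys
    using that by (induction rule: list_all2_induct) auto
  have "(oper M f xs, oper M f ys) \<in> carrier M \<times> carrier M"
    if "f \<in> symbols S" "length xs = arity S f"
      "list_all2 (\<lambda>x y. (x, y) \<in> carrier M \<times> carrier M) xs ys" for f xs ys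
  proof -
    have "length ys = arity S f" "set xs \<subseteq> carrier M" "set ys \<subseteq> carrier M"
      using that(2) *[OF that(3)] by auto
    then show ?thesis using that(1,2) assms by (simp add: is_algebra_def)
  qed
  moreover have "equiv (carrier M) (carrier M \<times> carrier M)"
    by (auto simp: equiv_def refl_on_def sym_def trans_def)
  ultimately show ?thesis unfolding Con_def by (intro CollectI conjI ballI allI impI) auto
qed

lemma Inter_in_Con:
  assumes "D \<subseteq> Con S M" "D \<noteq> {}"
  shows "\<Inter>D \<in> Con S M"
proof -
  have eq: "equiv (carrier M) \<theta>" if "\<theta> \<in> D" for \<theta> using that assms by (auto simp: Con_def)
  have "\<Inter>D \<subseteq> carrier M \<times> carrier M" using eq assms(2) unfolding equiv_def by fast
  moreover have "refl_on (carrier M) (\<Inter>D)" using eq by (simp add: equiv_def refl_on_def)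
  moreover have "sym (\<Inter>D)" using eq by (simp add: equiv_def sym_def)
  moreover have "trans (\<Inter>D)"
    using eq by (intro transI InterI) (metis InterD equiv_def transD)
  moreover have "(oper M f xs, oper M f ys) \<in> \<Inter>D"
    if "f \<in> symbols S" "length xs = arity S f" "list_all2 (\<lambda>x y. (x, y) \<in> \<Inter>D) xs ys" for f xs ys
  proof
    fix \<theta> assume "\<theta> \<in> D"
    have "list_all2 (\<lambda>x y. (x, y) \<in> \<theta>) xs ys"
      using that(3) by (rule list_all2_mono) (use \<open>\<theta> \<in> D\<close> in blast)
    then show "(oper M f xs, oper M f ys) \<in> \<theta>"
      using that(1,2) \<open>\<theta> \<in> D\<close> assms(1) unfolding Con_def by fast
  qed
  ultimately show ?thesis
    unfolding Con_def equiv_def by (intro CollectI conjI ballI allI impI) blast+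
qed

lemma commutator_is_least:
  assumes "is_algebra S M" "\<alpha> \<in> Con S M" "\<beta> \<in> Con S M"
  shows "commutator S M \<alpha> \<beta> \<in> Con S M"
    and "term_condition S M \<alpha> \<beta> (commutator S M \<alpha> \<beta>)"
    and "\<And>\<delta>. \<delta> \<in> Con S M \<Longrightarrow> term_condition S M \<alpha> \<beta> \<delta> \<Longrightarrow> commutator S M \<alpha> \<beta> \<subseteq> \<delta>"
proof -
  have sub: "\<alpha> \<subseteq> carrier M \<times> carrier M" "\<beta> \<subseteq> carrier M \<times> carrier M"
    using assms by (auto simp: Con_def equiv_def)
  have "term_condition S M \<alpha> \<beta> (carrier M \<times> carrier M)"
    unfolding term_condition_def
  proof (intro allI impI, elim conjE)
    fix t :: "('a, nat + nat) trm" and a b c d :: "nat \<Rightarrow> 'b"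
    assume t: "wf_trm S t" and ab: "\<forall>i. (a i, b i) \<in> \<alpha>" and cd: "\<forall>j. (c j, d j) \<in> \<beta>"
    have "b i \<in> carrier M" "c i \<in> carrier M" "d i \<in> carrier M" for i
      using ab cd sub by blast+
    then have "range (case_sum b c) \<subseteq> carrier M" "range (case_sum b d) \<subseteq> carrier M"
      by (auto simp: image_subset_iff split: sum.split)
    then show "(eval_trm M (case_sum b c) t, eval_trm M (case_sum b d) t) \<in> carrier M \<times> carrier M"
      using eval_trm_closed[OF assms(1) t] by simp
  qed
  then show "commutator S M \<alpha> \<beta> \<in> Con S M"
    unfolding commutator_def using full_in_Con[OF assms(1)] by (intro Inter_in_Con) auto
  show "term_condition S M \<alpha> \<beta> (commutator S M \<alpha> \<beta>)"
    unfolding commutator_def term_condition_def by blast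
  show "commutator S M \<alpha> \<beta> \<subseteq> \<delta>" if "\<delta> \<in> Con S M" "term_condition S M \<alpha> \<beta> \<delta>" for \<delta>
    using that by (auto simp: commutator_def)
qed

lemma lattice_con_lattice:
  assumes "is_algebra S M"
  shows "lattice (con_lattice S M)"
proof -
  interpret L: partial_order "con_lattice S M"
    by unfold_locales (auto simp: con_lattice_def)
  show ?thesis
  proof unfold_locales
    fix \<alpha> \<beta> assume "\<alpha> \<in> carrier (con_lattice S M)" "\<beta> \<in> carrier (con_lattice S M)"
    then have ab: "\<alpha> \<in> Con S M" "\<beta> \<in> Con S M" by (simp_all add: con_lattice_def)
    let ?U = "{\<theta> \<in> Con S M. \<alpha> \<subseteq> \<theta> \<and> \<beta> \<subseteq> \<theta>}"
    have "carrier M \<times> carrier M \<in> ?U"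
      using ab full_in_Con[OF assms] by (auto simp: Con_def equiv_def)
    then have "\<Inter>?U \<in> Con S M" by (intro Inter_in_Con) auto
    then show "\<exists>s. least (con_lattice S M) s (Upper (con_lattice S M) {\<alpha>, \<beta>})"
      by (intro exI[of _ "\<Inter>?U"]) (use ab in \<open>auto simp: least_def Upper_def con_lattice_def\<close>)
    have "\<Inter>{\<alpha>, \<beta>} \<in> Con S M" using ab by (intro Inter_in_Con) auto
    then show "\<exists>s. greatest (con_lattice S M) s (Lower (con_lattice S M) {\<alpha>, \<beta>})"
      by (intro exI[of _ "\<alpha> \<inter> \<beta>"]) (use ab in \<open>auto simp: greatest_def Lower_def con_lattice_def\<close>)
  qed
qed

definition prime_congruence :: "'f signature \<Rightarrow> ('f, 'a) algebra \<Rightarrow> ('a \<times> 'a) set \<Rightarrow> bool" where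
  "prime_congruence S M \<phi> \<longleftrightarrow> \<phi> \<in> Con S M \<and> \<phi> \<noteq> carrier M \<times> carrier M \<and>
     (\<forall>\<alpha>\<in>Con S M. \<forall>\<beta>\<in>Con S M. commutator S M \<alpha> \<beta> \<subseteq> \<phi> \<longrightarrow> \<alpha> \<subseteq> \<phi> \<or> \<beta> \<subseteq> \<phi>)"

definition Spec :: "'f signature \<Rightarrow> ('f, 'a) algebra \<Rightarrow> ('a \<times> 'a) set set" where
  "Spec S M = {\<phi>. prime_congruence S M \<phi>}"


section \<open>Admissibility, Going Up and Lying Over\<close>

definition pullback :: "('f, 'a) algebra \<Rightarrow> ('a \<Rightarrow> 'b) \<Rightarrow> ('b \<times> 'b) set \<Rightarrow> ('a \<times> 'a) set" where
  "pullback A f \<psi> = {(x, y). x \<in> carrier A \<and> y \<in> carrier A \<and> (f x, f y) \<in> \<psi>}"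

definition Ker :: "('f, 'a) algebra \<Rightarrow> ('f, 'b) algebra \<Rightarrow> ('a \<Rightarrow> 'b) \<Rightarrow> ('a \<times> 'a) set" where
  "Ker A B f = pullback A f (Id_on (carrier B))"

definition admissible :: "'f signature \<Rightarrow> ('f, 'a) algebra \<Rightarrow> ('f, 'b) algebra \<Rightarrow> ('a \<Rightarrow> 'b) \<Rightarrow> bool" where
  "admissible S A B f \<longleftrightarrow> (\<forall>\<psi>\<in>Spec S B. pullback A f \<psi> \<in> Spec S A)"

definition GU :: "'f signature \<Rightarrow> ('f, 'a) algebra \<Rightarrow> ('f, 'b) algebra \<Rightarrow> ('a \<Rightarrow> 'b) \<Rightarrow> bool" where
  "GU S A B f \<longleftrightarrow>
     (\<forall>\<phi>\<in>Spec S A. \<forall>\<psi>\<in>Spec S A. \<forall>\<phi>\<^sub>1\<in>Spec S B. \<phi> \<subseteq> \<psi> \<and> pullback A f \<phi>\<^sub>1 = \<phi> \<longrightarrow>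
        (\<exists>\<psi>\<^sub>1\<in>Spec S B. \<phi>\<^sub>1 \<subseteq> \<psi>\<^sub>1 \<and> pullback A f \<psi>\<^sub>1 = \<psi>))"

definition LO :: "'f signature \<Rightarrow> ('f, 'a) algebra \<Rightarrow> ('f, 'b) algebra \<Rightarrow> ('a \<Rightarrow> 'b) \<Rightarrow> bool" where
  "LO S A B f \<longleftrightarrow>
     (\<forall>\<phi>\<in>Spec S A. Ker A B f \<subseteq> \<phi> \<longrightarrow> (\<exists>\<phi>\<^sub>1\<in>Spec S B. pullback A f \<phi>\<^sub>1 = \<phi>))"

end

theory Submission
  imports Defs
begin

text \<open>The map \<open>h\<close> factors through the surjection \<open>M \<rightarrow> h(M)\<close>, and pulling back along this surjection
  is an order isomorphism from \<open>Con(h(M))\<close> onto the congruences of \<open>M\<close> above \<open>Ker(h)\<close>. All three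
  claims follow once this isomorphism is known to preserve and reflect primality. The point is that
  \<open>[\<alpha>, \<beta>] \<subseteq> \<phi>\<close> implies the term condition for \<open>\<alpha> \<or> \<phi>\<close>, \<open>\<beta> \<or> \<phi>\<close> modulo \<open>\<phi>\<close>; this needs the term
  condition to be symmetric in \<open>\<alpha>, \<beta>\<close> and inherited by larger congruences \<open>\<phi>\<close>. Both follow from Day
  terms, which come from modularity of the congruence lattice of a free algebra.\<close>

section \<open>Congruences and Day terms\<close>

lemma Con_equiv: "\<theta> \<in> Con S M \<Longrightarrow> equiv (carrier M) \<theta>"
  by (simp add: Con_def)

lemma Con_refl: "\<theta> \<in> Con S M \<Longrightarrow> x \<in> carrier M \<Longrightarrow> (x, x) \<in> \<theta>"
  by (meson Con_equiv equiv_def refl_onD)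

lemma Con_sym: "\<theta> \<in> Con S M \<Longrightarrow> (x, y) \<in> \<theta> \<Longrightarrow> (y, x) \<in> \<theta>"
  by (meson Con_equiv equiv_def symD)

lemma Con_trans: "\<theta> \<in> Con S M \<Longrightarrow> (x, y) \<in> \<theta> \<Longrightarrow> (y, z) \<in> \<theta> \<Longrightarrow> (x, z) \<in> \<theta>"
  by (meson Con_equiv equiv_def transD)

lemma Con_carrier:
  assumes "\<theta> \<in> Con S M" "(x, y) \<in> \<theta>"
  shows "x \<in> carrier M" "y \<in> carrier M"
  using assms by (auto simp: Con_def equiv_def)

lemma Con_oper:
  assumes "\<theta> \<in> Con S M" "f \<in> symbols S" "length xs = arity S f"
    "list_all2 (\<lambda>x y. (x, y) \<in> \<theta>) xs ys"
  shows "(oper M f xs, oper M f ys) \<in> \<theta>"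
  using assms unfolding Con_def by fast

lemma ConI:
  assumes "\<And>x y. (x, y) \<in> \<theta> \<Longrightarrow> x \<in> carrier M \<and> y \<in> carrier M"
    and "\<And>x. x \<in> carrier M \<Longrightarrow> (x, x) \<in> \<theta>"
    and "\<And>x y. (x, y) \<in> \<theta> \<Longrightarrow> (y, x) \<in> \<theta>"
    and "\<And>x y z. (x, y) \<in> \<theta> \<Longrightarrow> (y, z) \<in> \<theta> \<Longrightarrow> (x, z) \<in> \<theta>"
    and "\<And>f xs ys. f \<in> symbols S \<Longrightarrow> length xs = arity S f \<Longrightarrow>
      list_all2 (\<lambda>x y. (x, y) \<in> \<theta>) xs ys \<Longrightarrow> (oper M f xs, oper M f ys) \<in> \<theta>"
  shows "\<theta> \<in> Con S M"
  unfolding Con_def equiv_def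
  by (intro CollectI conjI subrelI refl_onI symI transI ballI allI impI) (use assms in blast)+

text \<open>Reflexivity and symmetry pass from \<alpha> \<union> \<beta> to its transitive closure.
  For an operation, the arguments are exchanged one at a time: a chain of \<alpha>- and
  \<beta>-links in one coordinate is carried over link by link, because both congruences are
  reflexive in the other coordinates.\<close>

lemma trancl_Un_in_Con:
  assumes \<alpha>: "\<alpha> \<in> Con S M" and \<beta>: "\<beta> \<in> Con S M"
  shows "(\<alpha> \<union> \<beta>)\<^sup>+ \<in> Con S M"
proof (rule ConI)
  let ?r = "\<alpha> \<union> \<beta>"
  have "?r \<subseteq> carrier M \<times> carrier M"
    using Con_carrier[OF \<alpha>] Con_carrier[OF \<beta>] by auto
  then have sub: "?r\<^sup>+ \<subseteq> carrier M \<times> carrier M" by (rule trancl_subset_Sigma)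
  then show "x \<in> carrier M \<and> y \<in> carrier M" if "(x, y) \<in> ?r\<^sup>+" for x y
    using that by auto
  show "(x, x) \<in> ?r\<^sup>+" if "x \<in> carrier M" for x
    using Con_refl[OF \<alpha> that] by blast
  show "(y, x) \<in> ?r\<^sup>+" if "(x, y) \<in> ?r\<^sup>+" for x y
    using that
  proof (rule symD[rotated])
    show "sym (?r\<^sup>+)"
      by (intro sym_trancl symI) (use Con_sym[OF \<alpha>] Con_sym[OF \<beta>] in blast)
  qed
  show "(x, z) \<in> ?r\<^sup>+" if "(x, y) \<in> ?r\<^sup>+" "(y, z) \<in> ?r\<^sup>+" for x y z
    using that by simp
  fix f xs ys
  assume f: "f \<in> symbols S" and len: "length xs = arity S f"
    and xy: "list_all2 (\<lambda>x y. (x, y) \<in> ?r\<^sup>+) xs ys"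
  have one: "(oper M f (us @ x # vs), oper M f (us @ y # vs)) \<in> ?r\<^sup>+"
    if xy: "(x, y) \<in> ?r\<^sup>+" and l: "length (us @ x # vs) = arity S f"
      and c: "set us \<subseteq> carrier M" "set vs \<subseteq> carrier M" for us vs x y
  proof -
    have coord: "(oper M f (us @ x # vs), oper M f (us @ y # vs)) \<in> \<theta>"
      if "(x, y) \<in> \<theta>" "\<theta> \<in> Con S M" "length (us @ x # vs) = arity S f" for x y \<theta>
    proof (rule Con_oper[OF that(2) f that(3)])
      have "list_all2 (\<lambda>x y. (x, y) \<in> \<theta>) ws ws" if "set ws \<subseteq> carrier M" for ws
        using that Con_refl[OF \<open>\<theta> \<in> Con S M\<close>] by (auto simp: list_all2_same)
      then show "list_all2 (\<lambda>x y. (x, y) \<in> \<theta>) (us @ x # vs) (us @ y # vs)"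
        using c that(1) by (intro list_all2_appendI) auto
    qed
    show ?thesis using xy
    proof (induction rule: trancl_induct)
      case (base y)
      then show ?case using coord[of x y] \<alpha> \<beta> l by auto
    next
      case (step y z)
      have "(oper M f (us @ y # vs), oper M f (us @ z # vs)) \<in> ?r"
        using coord[of y z] step(2) \<alpha> \<beta> l by auto
      then show ?case using step.IH by (rule trancl_into_trancl[rotated])
    qed
  qed
  \<comment> \<open>\<open>us\<close> collects the coordinates already exchanged; after an exchange
    of the head, the new entry moves to the end of this prefix.\<close>
  have ind: "(oper M f (us @ xs), oper M f (us @ ys)) \<in> ?r\<^sup>+"
    if "list_all2 (\<lambda>x y. (x, y) \<in> ?r\<^sup>+) xs ys" "length (us @ xs) = arity S f"
      "set us \<subseteq> carrier M" "us @ xs \<noteq> []" for us xs ys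
    using that
  proof (induction xs ys arbitrary: us rule: list_all2_induct)
    case Nil
    then have "list_all2 (\<lambda>x y. (x, y) \<in> \<alpha>) us us"
      using Con_refl[OF \<alpha>] by (auto simp: list_all2_same)
    then have "(oper M f us, oper M f us) \<in> \<alpha>"
      using Nil by (intro Con_oper[OF \<alpha> f]) auto
    then show ?case by auto
  next
    case (Cons x xs y ys)
    have "set xs \<subseteq> carrier M" using Cons(2) sub
      by (fastforce simp: list_all2_conv_all_nth in_set_conv_nth)
    then have "(oper M f (us @ x # xs), oper M f (us @ y # xs)) \<in> ?r\<^sup>+"
      using Cons.prems Cons.hyps by (intro one) auto
    moreover have "(oper M f ((us @ [y]) @ xs), oper M f ((us @ [y]) @ ys)) \<in> ?r\<^sup>+"
      using Cons.prems Cons.hyps sub by (intro Cons.IH) auto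
    ultimately show ?case by (simp add: trancl_trans)
  qed
  show "(oper M f xs, oper M f ys) \<in> ?r\<^sup>+"
  proof (cases "xs = []")
    case True
    then have "(oper M f xs, oper M f ys) \<in> \<alpha>"
      using xy len by (intro Con_oper[OF \<alpha> f]) auto
    then show ?thesis by auto
  qed (use xy len ind[of xs ys "[]"] in auto)
qed

lemma Int_in_Con:
  assumes "\<alpha> \<in> Con S M" "\<beta> \<in> Con S M"
  shows "\<alpha> \<inter> \<beta> \<in> Con S M"
  using Inter_in_Con[of "{\<alpha>, \<beta>}" S M] assms by simp

lemma trancl_Un_least:
  assumes "\<gamma> \<in> Con S M" "\<alpha> \<subseteq> \<gamma>" "\<beta> \<subseteq> \<gamma>"
  shows "(\<alpha> \<union> \<beta>)\<^sup>+ \<subseteq> \<gamma>"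
proof -
  have "(\<alpha> \<union> \<beta>)\<^sup>+ \<subseteq> \<gamma>\<^sup>+" using assms by (intro trancl_mono_subset) auto
  also have "\<gamma>\<^sup>+ = \<gamma>" using Con_equiv[OF assms(1)] by (auto simp: equiv_def trancl_id)
  finally show ?thesis .
qed

text \<open>Makes the modular law of \<open>con_lattice\<close> concrete: meets are intersections
  and joins are transitive closures of unions. The inclusion kept is the one that produces a chain
  of links.\<close>

lemma modular_lattice_trancl:
  assumes "modular_lattice (con_lattice S M)"
    and \<alpha>: "\<alpha> \<in> Con S M" and \<beta>: "\<beta> \<in> Con S M" and \<gamma>: "\<gamma> \<in> Con S M" and "\<alpha> \<subseteq> \<gamma>"
  shows "(\<alpha> \<union> \<beta>)\<^sup>+ \<inter> \<gamma> \<subseteq> (\<alpha> \<union> (\<beta> \<inter> \<gamma>))\<^sup>+"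
proof -
  let ?L = "con_lattice S M"
  interpret lattice ?L using assms(1) by (simp add: modular_lattice_def)
  have car: "carrier ?L = Con S M" and le: "\<And>x y. x \<sqsubseteq>\<^bsub>?L\<^esub> y \<longleftrightarrow> x \<subseteq> y"
    by (auto simp: con_lattice_def)
  have meet: "x \<sqinter>\<^bsub>?L\<^esub> y = x \<inter> y" if "x \<in> Con S M" "y \<in> Con S M" for x y
  proof
    show "x \<sqinter>\<^bsub>?L\<^esub> y \<subseteq> x \<inter> y"
      using meet_left[of x y] meet_right[of x y] that by (auto simp: car le)
    show "x \<inter> y \<subseteq> x \<sqinter>\<^bsub>?L\<^esub> y"
      using meet_le[of "x \<inter> y" x y] that Int_in_Con[of x S M y] by (auto simp: car le)
  qed
  have join: "x \<squnion>\<^bsub>?L\<^esub> y = (x \<union> y)\<^sup>+" if "x \<in> Con S M" "y \<in> Con S M" for x y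
  proof
    have "x \<subseteq> (x \<union> y)\<^sup>+" "y \<subseteq> (x \<union> y)\<^sup>+" by auto
    then show "x \<squnion>\<^bsub>?L\<^esub> y \<subseteq> (x \<union> y)\<^sup>+"
      using join_le[of x "(x \<union> y)\<^sup>+" y] that trancl_Un_in_Con[of x S M y]
      by (simp add: car le)
    show "(x \<union> y)\<^sup>+ \<subseteq> x \<squnion>\<^bsub>?L\<^esub> y"
      using join_left[of x y] join_right[of x y] join_closed[of x y] that
      by (intro trancl_Un_least) (auto simp: car le)
  qed
  have "\<alpha> \<squnion>\<^bsub>?L\<^esub> (\<beta> \<sqinter>\<^bsub>?L\<^esub> \<gamma>) = (\<alpha> \<squnion>\<^bsub>?L\<^esub> \<beta>) \<sqinter>\<^bsub>?L\<^esub> \<gamma>"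
    using assms by (auto simp: modular_lattice_def car le)
  then show ?thesis
    using \<alpha> \<beta> \<gamma> by (simp add: meet join Int_in_Con trancl_Un_in_Con)
qed

section \<open>Terms, substitution and the identities of an algebra\<close>

primrec subst_trm :: "('v \<Rightarrow> ('f, 'w) trm) \<Rightarrow> ('f, 'v) trm \<Rightarrow> ('f, 'w) trm" where
  "subst_trm \<rho> (Var x) = \<rho> x"
| "subst_trm \<rho> (App f ts) = App f (map (subst_trm \<rho>) ts)"

lemma eval_subst_trm: "eval_trm M \<sigma> (subst_trm \<rho> t) = eval_trm M (\<lambda>x. eval_trm M \<sigma> (\<rho> x)) t"
  by (induction t) (auto simp: comp_def cong: map_cong)

lemma wf_subst_trm: "wf_trm S t \<Longrightarrow> (\<And>x. wf_trm S (\<rho> x)) \<Longrightarrow> wf_trm S (subst_trm \<rho> t)"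
  by (induction t) auto

lemma eval_trm_cong_vars:
  "(\<And>x. x \<in> set2_trm t \<Longrightarrow> \<sigma> x = \<tau> x) \<Longrightarrow> eval_trm M \<sigma> t = eval_trm M \<tau> t"
proof (induction t)
  case (App f ts)
  then have "map (eval_trm M \<sigma>) ts = map (eval_trm M \<tau>) ts" by (intro map_cong) auto
  then show ?case by (simp only: eval_trm.simps)
qed simp

lemma finite_set2_trm: "finite (set2_trm t)"
  by (induction t) auto

lemma eval_trm_Con:
  assumes "\<theta> \<in> Con S M" "wf_trm S t" "\<And>x. (\<sigma> x, \<tau> x) \<in> \<theta>"
  shows "(eval_trm M \<sigma> t, eval_trm M \<tau> t) \<in> \<theta>"
  using assms(2)
proof (induction t)
  case (Var x)
  then show ?case using assms(3) by simp
next
  case (App f ts)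
  then have "list_all2 (\<lambda>x y. (x, y) \<in> \<theta>) (map (eval_trm M \<sigma>) ts) (map (eval_trm M \<tau>) ts)"
    by (auto simp: list_all2_map1 list_all2_map2 list_all2_same)
  then show ?case using App.prems by (auto intro: Con_oper[OF assms(1)])
qed

text \<open>For \<open>P\<close> constantly true, these are the identities of \<open>M\<close>. A
  stronger \<open>P\<close> gives the identities that hold once the variables are restricted by
  \<open>P\<close>.\<close>

definition agree ::
    "'f signature \<Rightarrow> ('f, 'a) algebra \<Rightarrow> (('v \<Rightarrow> 'a) \<Rightarrow> bool) \<Rightarrow> (('f, 'v) trm \<times> ('f, 'v) trm) set" where
  "agree S M P = {(s, t). wf_trm S s \<and> wf_trm S t \<and>
     (\<forall>\<sigma>. range \<sigma> \<subseteq> carrier M \<and> P \<sigma> \<longrightarrow> eval_trm M \<sigma> s = eval_trm M \<sigma> t)}"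

lemma agree_refl: "wf_trm S t \<Longrightarrow> (t, t) \<in> agree S M P"
  by (simp add: agree_def)

lemma agree_sym: "(s, t) \<in> agree S M P \<Longrightarrow> (t, s) \<in> agree S M P"
  by (simp add: agree_def)

lemma agree_trans: "(s, t) \<in> agree S M P \<Longrightarrow> (t, u) \<in> agree S M P \<Longrightarrow> (s, u) \<in> agree S M P"
  by (simp add: agree_def)

lemma agree_antimono: "(\<And>\<sigma>. Q \<sigma> \<Longrightarrow> P \<sigma>) \<Longrightarrow> agree S M P \<subseteq> agree S M Q"
  by (auto simp: agree_def)

lemma agree_App:
  assumes "f \<in> symbols S" "length ss = arity S f" "list_all2 (\<lambda>s t. (s, t) \<in> agree S M P) ss ts"
  shows "(App f ss, App f ts) \<in> agree S M P"
proof -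
  have "wf_trm S (App f ss)" "wf_trm S (App f ts)"
    using assms by (auto simp: agree_def list_all2_conv_all_nth in_set_conv_nth)
  moreover have "map (eval_trm M \<sigma>) ss = map (eval_trm M \<sigma>) ts"
    if "range \<sigma> \<subseteq> carrier M" "P \<sigma>" for \<sigma>
    using assms(3) that by (auto simp: agree_def list_all2_conv_all_nth intro!: nth_equalityI)
  ultimately show ?thesis unfolding agree_def by (auto simp del: wf_trm.simps)
qed

lemma agree_subst_trm:
  assumes M: "is_algebra S M" and st: "(s, t) \<in> agree S M (\<lambda>_. True)"
    and \<rho>: "\<And>x. wf_trm S (\<rho> x)"
  shows "(subst_trm \<rho> s, subst_trm \<rho> t) \<in> agree S M (\<lambda>_. True)"
  using st eval_trm_closed[OF M \<rho>]
  by (auto simp: agree_def eval_subst_trm image_subset_iff intro!: wf_subst_trm \<rho>)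

section \<open>The free algebra and its congruences\<close>

text \<open>The free algebra of the variety generated by \<open>M\<close>, realised on chosen representatives of the
  terms modulo the identities of \<open>M\<close> and carried over to another type by an injection \<open>e\<close>.\<close>

definition canonical :: "'f signature \<Rightarrow> ('f, 'a) algebra \<Rightarrow> ('f, 'v) trm \<Rightarrow> ('f, 'v) trm" where
  "canonical S M t = (SOME s. (s, t) \<in> agree S M (\<lambda>_. True))"

definition free_algebra ::
    "'f signature \<Rightarrow> ('f, 'a) algebra \<Rightarrow> (('f, 'v) trm \<Rightarrow> 'u) \<Rightarrow> ('f, 'u) algebra" where
  "free_algebra S M e = \<lparr>carrier = (\<lambda>t. e (canonical S M t)) ` {t. wf_trm S t},
     oper = (\<lambda>f xs. e (canonical S M (App f (map (inv e) xs))))\<rparr>"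

lemma canonical_agree: "wf_trm S t \<Longrightarrow> (canonical S M t, t) \<in> agree S M (\<lambda>_. True)"
  unfolding canonical_def by (rule someI) (rule agree_refl)

lemma wf_canonical: "wf_trm S t \<Longrightarrow> wf_trm S (canonical S M t)"
  using canonical_agree[of S t M] by (simp add: agree_def)

text \<open>By symmetry and transitivity of \<open>agree\<close>, both sides choose from the same
  class of terms.\<close>

lemma canonical_eq: "(s, t) \<in> agree S M (\<lambda>_. True) \<Longrightarrow> canonical S M s = canonical S M t"
  unfolding canonical_def by (rule arg_cong[where f = Eps]) (auto intro: agree_trans agree_sym)

text \<open>Evaluation in the free algebra is substitution of representatives: each operation
  replaces its result by a representative, which by \<open>agree_App\<close> changes nothing modulo
  the identities of \<open>M\<close>.\<close>

lemma eval_free_algebra: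
  fixes e :: "('f, 'v) trm \<Rightarrow> 'u" and t :: "('f, 'w) trm"
  assumes "inj e" "wf_trm S t" "range \<sigma> \<subseteq> carrier (free_algebra S M e)"
  shows "eval_trm (free_algebra S M e) \<sigma> t = e (canonical S M (subst_trm (\<lambda>x. inv e (\<sigma> x)) t))"
    and "wf_trm S (subst_trm (\<lambda>x. inv e (\<sigma> x)) t)"
proof -
  let ?\<rho> = "\<lambda>x. inv e (\<sigma> x)"
  have \<sigma>: "\<exists>s. wf_trm S s \<and> \<sigma> x = e (canonical S M s)" for x
    using assms(3) by (fastforce simp: free_algebra_def)
  have wf\<rho>: "wf_trm S (?\<rho> x)" for x
    using \<sigma>[of x] assms(1) by (auto simp: wf_canonical)
  have wf: "wf_trm S (subst_trm ?\<rho> s)" if "wf_trm S s" for s :: "('f, 'w) trm"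
    by (rule wf_subst_trm[OF that wf\<rho>])
  show "wf_trm S (subst_trm ?\<rho> t)" by (rule wf[OF assms(2)])
  show "eval_trm (free_algebra S M e) \<sigma> t = e (canonical S M (subst_trm ?\<rho> t))"
    using assms(2)
  proof (induction t)
    case (Var x)
    obtain s where "wf_trm S s" "\<sigma> x = e (canonical S M s)" using \<sigma> by blast
    then show ?case using assms(1) by (simp add: canonical_eq[OF canonical_agree])
  next
    case (App f ts)
    have "map (inv e) (map (eval_trm (free_algebra S M e) \<sigma>) ts) =
        map (\<lambda>t. canonical S M (subst_trm ?\<rho> t)) ts"
      using App assms(1) by auto
    moreover have "(App f (map (\<lambda>t. canonical S M (subst_trm ?\<rho> t)) ts),
        App f (map (subst_trm ?\<rho>) ts)) \<in> agree S M (\<lambda>_. True)"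
      using App.prems
      by (intro agree_App)
        (auto simp: list_all2_map1 list_all2_map2 list_all2_same intro!: canonical_agree wf)
    ultimately show ?case
      by (simp add: free_algebra_def canonical_eq[of "App f _" "App f (map (subst_trm ?\<rho>) ts)"]
          del: map_map wf_trm.simps)
  qed
qed

text \<open>The identities in \<open>E\<close> hold in \<open>M\<close>, and the identities of
  \<open>M\<close> are closed under substitution; by \<open>eval_free_algebra\<close> both sides
  then have the same representative.\<close>

lemma free_algebra_in_equational_class:
  fixes e :: "('f, 'v) trm \<Rightarrow> 'u"
  assumes e: "inj e" and "wf_identities S E" and M: "M \<in> equational_class S E"
  shows "free_algebra S M e \<in> equational_class S E"
proof -
  let ?F = "free_algebra S M e"
  have alg: "is_algebra S M" using M by (simp add: equational_class_def)
  have "carrier ?F \<noteq> {}" by (auto simp: free_algebra_def intro: exI[of _ "Var _"])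
  moreover have "oper ?F f xs \<in> carrier ?F"
    if "f \<in> symbols S" "length xs = arity S f" "set xs \<subseteq> carrier ?F" for f xs
    using that e
    by (auto simp: free_algebra_def intro!: imageI) (auto simp: wf_canonical subset_iff image_iff)
  ultimately have "is_algebra S ?F" by (simp add: is_algebra_def)
  moreover have "eval_trm ?F \<sigma> s = eval_trm ?F \<sigma> t"
    if st: "(s, t) \<in> E" and \<sigma>: "range \<sigma> \<subseteq> carrier ?F" for s t \<sigma>
  proof -
    have wf: "wf_trm S s" "wf_trm S t" using assms(2) st by (auto simp: wf_identities_def)
    have "(s, t) \<in> agree S M (\<lambda>_. True)"
      using wf st M by (auto simp: agree_def equational_class_def)
    then have "(subst_trm (\<lambda>x. inv e (\<sigma> x)) s, subst_trm (\<lambda>x. inv e (\<sigma> x)) t)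
        \<in> agree S M (\<lambda>_. True)"
      using eval_free_algebra(2)[OF e _ \<sigma>, of "Var _"]
      by (intro agree_subst_trm alg) auto
    then show ?thesis
      using eval_free_algebra(1)[OF e _ \<sigma>] wf canonical_eq by metis
  qed
  ultimately show ?thesis by (auto simp: equational_class_def)
qed

text \<open>When \<open>P\<close> is a conjunction of equations between variables, this is the
  congruence of the free algebra generated by the corresponding pairs of generators, given
  semantically instead of by generation.\<close>

definition free_con ::
    "'f signature \<Rightarrow> ('f, 'a) algebra \<Rightarrow> (('f, 'v) trm \<Rightarrow> 'u) \<Rightarrow> (('v \<Rightarrow> 'a) \<Rightarrow> bool) \<Rightarrow> ('u \<times> 'u) set" where
  "free_con S M e P = {(v, w). v \<in> carrier (free_algebra S M e) \<and> w \<in> carrier (free_algebra S M e) \<and>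
     (inv e v, inv e w) \<in> agree S M P}"

lemma free_con_in_Con:
  assumes e: "inj e"
  shows "free_con S M e P \<in> Con S (free_algebra S M e)"
proof (rule ConI)
  let ?F = "free_algebra S M e"
  have inve: "wf_trm S (inv e v)" if "v \<in> carrier ?F" for v
    using that e by (auto simp: free_algebra_def wf_canonical)
  show "v \<in> carrier ?F \<and> w \<in> carrier ?F" if "(v, w) \<in> free_con S M e P" for v w
    using that by (simp add: free_con_def)
  show "(v, v) \<in> free_con S M e P" if "v \<in> carrier ?F" for v
    using that inve by (simp add: free_con_def agree_refl)
  show "(w, v) \<in> free_con S M e P" if "(v, w) \<in> free_con S M e P" for v w
    using that by (simp add: free_con_def agree_sym)
  show "(u, w) \<in> free_con S M e P"
    if "(u, v) \<in> free_con S M e P" "(v, w) \<in> free_con S M e P" for u v w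
    using that by (auto simp: free_con_def intro: agree_trans)
  fix f xs ys
  assume f: "f \<in> symbols S" and len: "length xs = arity S f"
    and xy: "list_all2 (\<lambda>x y. (x, y) \<in> free_con S M e P) xs ys"
  let ?s = "App f (map (inv e) xs)" and ?t = "App f (map (inv e) ys)"
  have st: "(?s, ?t) \<in> agree S M P"
    using xy len
    by (intro agree_App f)
      (auto simp: list_all2_map1 list_all2_map2 free_con_def elim: list_all2_mono)
  then have wf: "wf_trm S ?s" "wf_trm S ?t" by (auto simp: agree_def simp del: wf_trm.simps)
  \<comment> \<open>The operations return representatives of the compound terms. Every
    \<open>agree\<close> contains the identities of \<open>M\<close>, so passing to representatives
    is harmless.\<close>
  have "agree S M (\<lambda>_. True) \<subseteq> agree S M P" by (rule agree_antimono) simp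
  then have "(canonical S M ?s, ?s) \<in> agree S M P" "(?t, canonical S M ?t) \<in> agree S M P"
    using canonical_agree wf agree_sym by blast+
  then have "(canonical S M ?s, canonical S M ?t) \<in> agree S M P"
    using st agree_trans by blast
  then show "(oper ?F f xs, oper ?F f ys) \<in> free_con S M e P"
    using wf e by (auto simp: free_algebra_def free_con_def simp del: wf_trm.simps)
qed

section \<open>Day terms from modularity\<close>

text \<open>Links between consecutive Day terms \<open>m(x, y, z, u)\<close>, the variables 0 to 3
  being x, y, z, u: either the values at \<open>(x, y, y, u)\<close> agree, or those at
  \<open>(x, x, u, u)\<close> and those at \<open>(x, y, y, x)\<close> do. Both kinds of link
  preserve the identity \<open>m(x, y, y, x) = x\<close>, which therefore travels along the chain
  from \<open>Var 0\<close>.\<close>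

definition day_chain :: "'f signature \<Rightarrow> ('f, 'a) algebra \<Rightarrow> (('f, nat) trm \<times> ('f, nat) trm) set" where
  "day_chain S M = agree S M (\<lambda>\<sigma>. \<sigma> 1 = \<sigma> 2) \<union>
     (agree S M (\<lambda>\<sigma>. \<sigma> 0 = \<sigma> 1 \<and> \<sigma> 2 = \<sigma> 3) \<inter> agree S M (\<lambda>\<sigma>. \<sigma> 0 = \<sigma> 3 \<and> \<sigma> 1 = \<sigma> 2))"

text \<open>Day's argument in the free algebra. The generators satisfy \<open>?x 0\<close> \<Phi>
  \<open>?x 1\<close> \<Psi> \<open>?x 2\<close> \<Phi> \<open>?x 3\<close> and \<open>?x 0\<close>
  \<Theta> \<open>?x 3\<close>, and \<Psi> lies below \<Theta>. Modularity puts the pair of outer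
  generators into the join of \<Psi> with the meet of \<Phi> and \<Theta>; the elements of the
  resulting chain are the Day terms.\<close>

lemma day_terms:
  fixes e :: "('f, nat) trm \<Rightarrow> 'u"
  assumes e: "inj e" and mod: "modular_lattice (con_lattice S (free_algebra S M e))"
  shows "(Var 0, Var 3) \<in> (day_chain S M)\<^sup>+"
proof -
  let ?\<Psi> = "\<lambda>\<sigma> :: nat \<Rightarrow> _. \<sigma> 1 = \<sigma> 2" and ?\<Phi> = "\<lambda>\<sigma> :: nat \<Rightarrow> _. \<sigma> 0 = \<sigma> 1 \<and> \<sigma> 2 = \<sigma> 3"
    and ?\<Theta> = "\<lambda>\<sigma> :: nat \<Rightarrow> _. \<sigma> 0 = \<sigma> 3 \<and> \<sigma> 1 = \<sigma> 2"
  let ?c = "free_con S M e" and ?x = "\<lambda>n. e (canonical S M (Var n))"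
  have canon: "(canonical S M (Var n), Var n) \<in> agree S M P" for n P
    using canonical_agree[of S "Var n" M] agree_antimono[of P "\<lambda>_. True" S M] by auto
  have gen: "(?x i, ?x j) \<in> ?c P" if "\<And>\<sigma>. P \<sigma> \<Longrightarrow> \<sigma> i = \<sigma> j" for i j P
  proof -
    have "(Var i, Var j) \<in> agree S M P" using that by (simp add: agree_def)
    then have "(canonical S M (Var i), canonical S M (Var j)) \<in> agree S M P"
      using canon agree_sym agree_trans by metis
    then show ?thesis using e by (auto simp: free_con_def free_algebra_def)
  qed
  have "(?x 0, ?x 1) \<in> ?c ?\<Phi>" "(?x 1, ?x 2) \<in> ?c ?\<Psi>" "(?x 2, ?x 3) \<in> ?c ?\<Phi>"
    by (rule gen; simp)+
  then have "(?x 0, ?x 3) \<in> (?c ?\<Psi> \<union> ?c ?\<Phi>)\<^sup>+"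
    by (meson UnCI r_into_trancl' trancl_into_trancl)
  moreover have "(?x 0, ?x 3) \<in> ?c ?\<Theta>" by (rule gen) simp
  moreover have "?c ?\<Psi> \<subseteq> ?c ?\<Theta>"
    using agree_antimono[of ?\<Theta> ?\<Psi> S M] by (auto simp: free_con_def)
  ultimately have "(?x 0, ?x 3) \<in> (?c ?\<Psi> \<union> (?c ?\<Phi> \<inter> ?c ?\<Theta>))\<^sup>+"
    using modular_lattice_trancl[OF mod] free_con_in_Con[OF e] by blast
  then have "(inv e (?x 0), inv e (?x 3)) \<in> (day_chain S M)\<^sup>+"
  proof (induction rule: trancl_induct)
    case (base y)
    then show ?case by (auto simp: free_con_def day_chain_def)
  next
    case (step y z)
    then show ?case by (auto simp: free_con_def day_chain_def intro: trancl_into_trancl)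
  qed
  then have "(canonical S M (Var 0), canonical S M (Var 3)) \<in> (day_chain S M)\<^sup>+"
    using e by simp
  \<comment> \<open>The chain found runs between representatives of the two variables; one link of
    the first kind at each end leads to the variables themselves.\<close>
  moreover have "(Var 0, canonical S M (Var 0)) \<in> day_chain S M"
    "(canonical S M (Var 3), Var 3) \<in> day_chain S M"
    unfolding day_chain_def by (intro UnI1 canon agree_sym[OF canon])+
  ultimately show ?thesis by (meson trancl_into_trancl trancl_into_trancl2)
qed

section \<open>The term condition\<close>

text \<open>The corners are listed going round the square, so p, q form one side and r, s the
  opposite one. All variables from 3 on receive r, which makes the assignment total.\<close>

definition quad :: "'a \<Rightarrow> 'a \<Rightarrow> 'a \<Rightarrow> 'a \<Rightarrow> nat \<Rightarrow> 'a" where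
  "quad p q s r n = (if n = 0 then p else if n = 1 then q else if n = 2 then s else r)"

lemma quad_simps [simp]:
  "quad p q s r 0 = p" "quad p q s r (Suc 0) = q" "quad p q s r 2 = s" "quad p q s r 3 = r"
  by (simp_all add: quad_def)

lemma range_quad: "{p, q, s, r} \<subseteq> A \<Longrightarrow> range (quad p q s r) \<subseteq> A"
  by (auto simp: quad_def)

lemma quad_Con:
  assumes "(p, p') \<in> \<theta>" "(q, q') \<in> \<theta>" "(s, s') \<in> \<theta>" "(r, r') \<in> \<theta>"
  shows "(quad p q s r n, quad p' q' s' r' n) \<in> \<theta>"
  using assms by (simp add: quad_def)

lemma eval_subst_quad:
  "eval_trm M \<sigma> (subst_trm (quad s\<^sub>1 s\<^sub>2 s\<^sub>3 s\<^sub>4) m) =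
     eval_trm M (quad (eval_trm M \<sigma> s\<^sub>1) (eval_trm M \<sigma> s\<^sub>2) (eval_trm M \<sigma> s\<^sub>3) (eval_trm M \<sigma> s\<^sub>4)) m"
  unfolding eval_subst_trm
  by (rule arg_cong[where f = "\<lambda>\<tau>. eval_trm M \<tau> m"]) (auto simp: quad_def)

text \<open>Day's identity \<open>m(x, y, y, x) = x\<close>.\<close>

abbreviation day_term :: "'f signature \<Rightarrow> ('f, 'a) algebra \<Rightarrow> ('f, nat) trm \<Rightarrow> bool" where
  "day_term S M m \<equiv> (Var 0, m) \<in> agree S M (\<lambda>\<sigma>. \<sigma> 0 = \<sigma> 3 \<and> \<sigma> 1 = \<sigma> 2)"

lemma eval_day_term:
  assumes "day_term S M m" "p \<in> carrier M" "q \<in> carrier M"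
  shows "eval_trm M (quad p q q p) m = p"
proof -
  have "eval_trm M (quad p q q p) (Var 0) = eval_trm M (quad p q q p) m"
    using assms range_quad[of p q q p "carrier M"] by (auto simp: agree_def simp del: eval_trm.simps)
  then show ?thesis by simp
qed

text \<open>Along a Day chain, \<open>m(p, p, r, r)\<close> stays in one \<open>\<delta>\<close>-class: a link either preserves it, or
  preserves \<open>m(p, q, q, r)\<close>, which is \<open>\<delta>\<close>-related to \<open>m(p, q, s, r)\<close> and hence to \<open>m(p, p, r, r)\<close>.\<close>

lemma day_parallelogram:
  assumes chain: "(Var 0, Var 3) \<in> (day_chain S M)\<^sup>+"
    and \<delta>: "\<delta> \<in> Con S M" and qs: "(q, s) \<in> \<delta>" and pr: "p \<in> carrier M" "r \<in> carrier M"
    and day: "\<And>m. day_term S M m \<Longrightarrow>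
      (eval_trm M (quad p p r r) m, eval_trm M (quad p q s r) m) \<in> \<delta>"
  shows "(p, r) \<in> \<delta>"
proof -
  have qsM: "q \<in> carrier M" "s \<in> carrier M" using Con_carrier[OF \<delta> qs] .
  note r1 = range_quad[of p p r r "carrier M"] and r2 = range_quad[of p q q r "carrier M"]
  have link: "day_term S M m' \<and>
      (eval_trm M (quad p p r r) m, eval_trm M (quad p p r r) m') \<in> \<delta>"
    if m: "day_term S M m" and mm': "(m, m') \<in> day_chain S M" for m m'
  proof (cases "(m, m') \<in> agree S M (\<lambda>\<sigma>. \<sigma> 1 = \<sigma> 2)")
    case True
    then have "(m, m') \<in> agree S M (\<lambda>\<sigma>. \<sigma> 0 = \<sigma> 3 \<and> \<sigma> 1 = \<sigma> 2)" by (auto simp: agree_def)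
    then have m': "day_term S M m'" using m by (rule agree_trans[rotated])
    have wf: "wf_trm S m" "wf_trm S m'"
      and eq: "eval_trm M (quad p q q r) m = eval_trm M (quad p q q r) m'"
      using True r2 pr qsM by (auto simp: agree_def)
    have *: "(eval_trm M (quad p q s r) k, eval_trm M (quad p q q r) k) \<in> \<delta>"
      if "wf_trm S k" for k
      using that pr qs qsM \<delta> by (intro eval_trm_Con[OF \<delta>] quad_Con) (auto intro: Con_refl Con_sym)
    have "(eval_trm M (quad p p r r) m, eval_trm M (quad p q q r) m) \<in> \<delta>"
      using Con_trans[OF \<delta> day[OF m] *[OF wf(1)]] .
    moreover have "(eval_trm M (quad p q q r) m', eval_trm M (quad p p r r) m') \<in> \<delta>"
      using Con_sym[OF \<delta> Con_trans[OF \<delta> day[OF m'] *[OF wf(2)]]] .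
    ultimately show ?thesis using m' eq Con_trans[OF \<delta>] by metis
  next
    case False
    then have \<Phi>: "(m, m') \<in> agree S M (\<lambda>\<sigma>. \<sigma> 0 = \<sigma> 1 \<and> \<sigma> 2 = \<sigma> 3)"
      and \<Theta>: "(m, m') \<in> agree S M (\<lambda>\<sigma>. \<sigma> 0 = \<sigma> 3 \<and> \<sigma> 1 = \<sigma> 2)"
      using mm' by (auto simp: day_chain_def)
    have wf: "wf_trm S m" and eq: "eval_trm M (quad p p r r) m = eval_trm M (quad p p r r) m'"
      using \<Phi> r1 pr by (auto simp: agree_def)
    have "(eval_trm M (quad p p r r) m, eval_trm M (quad p p r r) m) \<in> \<delta>"
      using wf pr by (intro eval_trm_Con[OF \<delta>] quad_Con) (auto intro: Con_refl[OF \<delta>])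
    then show ?thesis using agree_trans[OF m \<Theta>] eq by simp
  qed
  have day0: "day_term S M (Var 0)" by (simp add: agree_refl)
  \<comment> \<open>The chain starts at \<open>Var 0\<close>, whose value here is p, and ends at
    \<open>Var 3\<close>, whose value is r.\<close>
  have "day_term S M m \<and> (p, eval_trm M (quad p p r r) m) \<in> \<delta>"
    if "(Var 0, m) \<in> (day_chain S M)\<^sup>+" for m
    using that
  proof (induction rule: trancl_induct)
    case (base m)
    then show ?case using link[OF day0] by auto
  next
    case (step m m')
    then show ?case using link[of m m'] Con_trans[OF \<delta>] by blast
  qed
  from this[OF chain] show ?thesis by simp
qed

section \<open>Symmetry, monotonicity and joins for the term condition\<close>

lemma term_conditionD:
  fixes t :: "('f, nat + nat) trm" and a b c d :: "nat \<Rightarrow> 'a"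
  assumes "term_condition S M \<alpha> \<beta> \<delta>" "wf_trm S t" "\<And>i. (a i, b i) \<in> \<alpha>" "\<And>j. (c j, d j) \<in> \<beta>"
    "(eval_trm M (case_sum a c) t, eval_trm M (case_sum a d) t) \<in> \<delta>"
  shows "(eval_trm M (case_sum b c) t, eval_trm M (case_sum b d) t) \<in> \<delta>"
  using assms unfolding term_condition_def by blast

lemma eval_case_sum_closed:
  assumes "is_algebra S M" "wf_trm S t" "\<And>i. a i \<in> carrier M" "\<And>j. c j \<in> carrier M"
  shows "eval_trm M (case_sum a c) t \<in> carrier M"
  using assms by (intro eval_trm_closed) (auto split: sum.split)

text \<open>Two copies of the variables of \<open>t\<close>, indexed by the even and the odd numbers, make the Day term
  of the corners of an \<open>\<alpha>\<close>-\<open>\<beta>\<close>-matrix part of another \<open>\<alpha>\<close>-\<open>\<beta>\<close>-matrix whose first row is constant.\<close>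

lemma term_condition_day_term:
  fixes t :: "('f, nat + nat) trm" and a b c d :: "nat \<Rightarrow> 'a"
  assumes M: "is_algebra S M" and \<alpha>: "\<alpha> \<in> Con S M" and \<beta>: "\<beta> \<in> Con S M" and \<delta>: "\<delta> \<in> Con S M"
    and tc: "term_condition S M \<alpha> \<beta> \<delta>"
    and t: "wf_trm S t" and ab: "\<And>i. (a i, b i) \<in> \<alpha>" and cd: "\<And>j. (c j, d j) \<in> \<beta>"
    and m: "day_term S M m"
  defines "p \<equiv> eval_trm M (case_sum a c) t" and "q \<equiv> eval_trm M (case_sum a d) t"
    and "r \<equiv> eval_trm M (case_sum b c) t" and "s \<equiv> eval_trm M (case_sum b d) t"
  shows "(eval_trm M (quad p p r r) m, eval_trm M (quad p q s r) m) \<in> \<delta>"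
proof -
  have car: "a i \<in> carrier M" "b i \<in> carrier M" "c i \<in> carrier M" "d i \<in> carrier M" for i
    using Con_carrier[OF \<alpha> ab] Con_carrier[OF \<beta> cd] by auto
  have pq: "p \<in> carrier M" "q \<in> carrier M"
    unfolding p_def q_def using M t car by (auto intro: eval_case_sum_closed)
  define copy where "copy i j = subst_trm (\<lambda>x. Var (map_sum (\<lambda>n. 2 * n + i) (\<lambda>n. 2 * n + j) x)) t"
    for i j :: nat
  have copy: "eval_trm M (case_sum u v) (copy i j) =
      eval_trm M (case_sum (\<lambda>n. u (2 * n + i)) (\<lambda>n. v (2 * n + j))) t" for u v i j
    unfolding copy_def eval_subst_trm
    by (rule arg_cong[where f = "\<lambda>\<tau>. eval_trm M \<tau> t"]) (auto split: sum.split)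
  define T where "T = subst_trm (quad (copy 0 0) (copy 0 1) (copy 1 1) (copy 1 0)) m"
  have "wf_trm S (copy i j)" for i j unfolding copy_def by (rule wf_subst_trm[OF t]) simp
  moreover have "wf_trm S m" using m by (simp add: agree_def)
  ultimately have wfT: "wf_trm S T" unfolding T_def by (intro wf_subst_trm) (auto simp: quad_def)
  define dup where "dup u v n = (if even n then u (n div 2) else v (n div 2))"
    for u v :: "nat \<Rightarrow> 'a" and n
  have dup: "dup u v (2 * n) = u n" "dup u v (Suc (2 * n)) = v n" for u v n
    by (simp_all add: dup_def)
  have eval: "eval_trm M (case_sum (dup u u') (dup v v')) T =
      eval_trm M (quad (eval_trm M (case_sum u v) t) (eval_trm M (case_sum u v') t)
        (eval_trm M (case_sum u' v') t) (eval_trm M (case_sum u' v) t)) m" for u u' v v'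
    by (simp add: T_def eval_subst_quad copy dup)
  \<comment> \<open>The entries of the first row are \<open>m(p, p, p, p)\<close> and
    \<open>m(p, q, q, p)\<close>, both equal to p by Day's identity.\<close>
  have "eval_trm M (case_sum (dup a a) (dup c c)) T = eval_trm M (case_sum (dup a a) (dup c d)) T"
    unfolding eval using eval_day_term[OF m] pq by (simp flip: p_def q_def)
  moreover have "eval_trm M (case_sum (dup a a) (dup c c)) T \<in> carrier M"
    using M wfT car by (intro eval_case_sum_closed) (auto simp: dup_def)
  ultimately have "(eval_trm M (case_sum (dup a a) (dup c c)) T,
      eval_trm M (case_sum (dup a a) (dup c d)) T) \<in> \<delta>"
    using Con_refl[OF \<delta>] by simp
  \<comment> \<open>Trading a for b at the odd x-variables turns the two entries into
    \<open>m(p, p, r, r)\<close> and \<open>m(p, q, s, r)\<close>.\<close>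
  then have "(eval_trm M (case_sum (dup a b) (dup c c)) T,
      eval_trm M (case_sum (dup a b) (dup c d)) T) \<in> \<delta>"
    by (rule term_conditionD[OF tc wfT, rotated 2])
      (use car ab cd Con_refl[OF \<alpha>] Con_refl[OF \<beta>] in \<open>auto simp: dup_def\<close>)
  then show ?thesis by (simp add: eval flip: p_def q_def r_def s_def)
qed

text \<open>The term condition modulo \<delta> relates the Day terms of the corners of any
  \<alpha>-\<beta>-matrix, and these relations persist modulo \<epsilon>. By
  \<open>day_parallelogram\<close> they carry an \<epsilon>-relation from one side of the matrix to
  the opposite one in the transposed direction, so symmetry and passage to a larger congruence come
  together.\<close>

lemma term_condition_commute_mono:
  fixes S :: "'f signature" and M :: "('f, 'a) algebra"
  assumes M: "is_algebra S M" and chain: "(Var 0, Var 3) \<in> (day_chain S M)\<^sup>+"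
    and \<alpha>: "\<alpha> \<in> Con S M" and \<beta>: "\<beta> \<in> Con S M" and \<delta>: "\<delta> \<in> Con S M" and \<epsilon>: "\<epsilon> \<in> Con S M"
    and "\<delta> \<subseteq> \<epsilon>" and tc: "term_condition S M \<alpha> \<beta> \<delta>"
  shows "term_condition S M \<beta> \<alpha> \<epsilon>"
  unfolding term_condition_def
proof (intro allI impI, elim conjE)
  fix t :: "('f, nat + nat) trm" and a b c d :: "nat \<Rightarrow> 'a"
  assume t: "wf_trm S t" and ab: "\<forall>i. (a i, b i) \<in> \<beta>" and cd: "\<forall>j. (c j, d j) \<in> \<alpha>"
    and prem: "(eval_trm M (case_sum a c) t, eval_trm M (case_sum a d) t) \<in> \<epsilon>"
  \<comment> \<open>Exchanging the two sorts of variables transposes the matrix, so that the pairs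
    in \<alpha> sit at the x-variables, as \<open>tc\<close> requires.\<close>
  define t' where "t' = subst_trm (\<lambda>x. Var (case_sum Inr Inl x)) t"
  have wf: "wf_trm S t'" unfolding t'_def by (rule wf_subst_trm[OF t]) simp
  have swap: "eval_trm M (case_sum u v) t' = eval_trm M (case_sum v u) t" for u v
    unfolding t'_def eval_subst_trm
    by (rule arg_cong[where f = "\<lambda>\<tau>. eval_trm M \<tau> t"]) (auto split: sum.split)
  \<comment> \<open>With b before a, the corners p and r are the two values to be related, and q and
    s are those of the premise.\<close>
  have ba: "(b i, a i) \<in> \<beta>" for i using ab Con_sym[OF \<beta>] by blast
  have car: "b i \<in> carrier M" "c i \<in> carrier M" "d i \<in> carrier M" for i
    using Con_carrier[OF \<beta> ba] Con_carrier[OF \<alpha> spec[OF cd]] by auto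
  show "(eval_trm M (case_sum b c) t, eval_trm M (case_sum b d) t) \<in> \<epsilon>"
  proof (rule day_parallelogram[OF chain \<epsilon> prem])
    fix m assume "day_term S M m"
    then show "(eval_trm M (quad (eval_trm M (case_sum b c) t) (eval_trm M (case_sum b c) t)
        (eval_trm M (case_sum b d) t) (eval_trm M (case_sum b d) t)) m,
      eval_trm M (quad (eval_trm M (case_sum b c) t) (eval_trm M (case_sum a c) t)
        (eval_trm M (case_sum a d) t) (eval_trm M (case_sum b d) t)) m) \<in> \<epsilon>"
      using term_condition_day_term[OF M \<alpha> \<beta> \<delta> tc wf _ ba, of c d m] cd \<open>\<delta> \<subseteq> \<epsilon>\<close>
      by (auto simp: swap)
  qed (use M t car in \<open>auto intro: eval_case_sum_closed\<close>)
qed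

text \<open>The row tuple a is changed into b one coordinate at a time, following a chain of
  \<alpha>- and \<alpha>'-links in that coordinate; each link is one application of
  \<open>tc\<close> or \<open>tc'\<close>, with all other coordinates fixed by reflexivity.\<close>

lemma term_condition_trancl_Un:
  fixes S :: "'f signature" and M :: "('f, 'a) algebra"
  assumes \<alpha>: "\<alpha> \<in> Con S M" and \<alpha>': "\<alpha>' \<in> Con S M"
    and tc: "term_condition S M \<alpha> \<beta> \<delta>" and tc': "term_condition S M \<alpha>' \<beta> \<delta>"
  shows "term_condition S M ((\<alpha> \<union> \<alpha>')\<^sup>+) \<beta> \<delta>"
  unfolding term_condition_def
proof (intro allI impI, elim conjE)
  fix t :: "('f, nat + nat) trm" and a b c d :: "nat \<Rightarrow> 'a"
  assume t: "wf_trm S t" and ab: "\<forall>i. (a i, b i) \<in> (\<alpha> \<union> \<alpha>')\<^sup>+" and cd: "\<forall>j. (c j, d j) \<in> \<beta>"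
    and prem: "(eval_trm M (case_sum a c) t, eval_trm M (case_sum a d) t) \<in> \<delta>"
  let ?R = "\<lambda>a. (eval_trm M (case_sum a c) t, eval_trm M (case_sum a d) t) \<in> \<delta>"
  have car: "a i \<in> carrier M" "b i \<in> carrier M" for i
    using Con_carrier[OF trancl_Un_in_Con[OF \<alpha> \<alpha>']] ab by blast+
  have one: "?R (u(i := y))" if u: "\<And>j. u j \<in> carrier M" and "?R u" and y: "(u i, y) \<in> (\<alpha> \<union> \<alpha>')\<^sup>+"
    for u i y
  proof -
    have link: "?R (u(i := w))" if vw: "(v, w) \<in> \<alpha> \<union> \<alpha>'" and v: "?R (u(i := v))" for v w
    proof (cases "(v, w) \<in> \<alpha>")
      case True
      show ?thesis
        by (rule term_conditionD[OF tc t _ _ v]) (use True u cd Con_refl[OF \<alpha>] in auto)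
    next
      case False
      show ?thesis
        by (rule term_conditionD[OF tc' t _ _ v]) (use False vw u cd Con_refl[OF \<alpha>'] in auto)
    qed
    show ?thesis using y
    proof (induction rule: trancl_induct)
      case (base y)
      then show ?case using link[of "u i" y] \<open>?R u\<close> by simp
    next
      case (step y z)
      then show ?case using link by blast
    qed
  qed
  have mix: "?R (\<lambda>i. if i \<in> I then b i else a i)" if "finite I" for I
    using that
  proof induction
    case empty
    then show ?case using prem by (simp only: empty_iff if_False)
  next
    case (insert i I)
    have eq: "(\<lambda>j. if j \<in> insert i I then b j else a j) = (\<lambda>j. if j \<in> I then b j else a j)(i := b i)"
      by auto
    show ?case unfolding eq by (rule one[OF _ insert.IH]) (use insert.hyps car ab in auto)
  qed
  \<comment> \<open>The tuples are infinite, but only the finitely many x-variables occurring in t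
    have to be exchanged.\<close>
  let ?I = "Inl -` set2_trm t"
  have "finite ?I" by (intro finite_vimageI finite_set2_trm) simp
  moreover have "eval_trm M (case_sum (\<lambda>i. if i \<in> ?I then b i else a i) e) t =
      eval_trm M (case_sum b e) t" for e
    by (rule eval_trm_cong_vars) (auto split: sum.split)
  ultimately show "?R b" using mix[of ?I] by simp
qed

text \<open>Corresponding entries of the two rows are \<delta>-related, so the implication follows
  by transitivity.\<close>

lemma term_condition_subset:
  fixes S :: "'f signature" and M :: "('f, 'a) algebra"
  assumes \<alpha>: "\<alpha> \<in> Con S M" and \<beta>: "\<beta> \<in> Con S M" and \<delta>: "\<delta> \<in> Con S M" and "\<alpha> \<subseteq> \<delta>"
  shows "term_condition S M \<alpha> \<beta> \<delta>"
  unfolding term_condition_def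
proof (intro allI impI, elim conjE)
  fix t :: "('f, nat + nat) trm" and a b c d :: "nat \<Rightarrow> 'a"
  assume t: "wf_trm S t" and ab: "\<forall>i. (a i, b i) \<in> \<alpha>" and cd: "\<forall>j. (c j, d j) \<in> \<beta>"
    and prem: "(eval_trm M (case_sum a c) t, eval_trm M (case_sum a d) t) \<in> \<delta>"
  have *: "(eval_trm M (case_sum a e) t, eval_trm M (case_sum b e) t) \<in> \<delta>"
    if "\<And>j. e j \<in> carrier M" for e
    using ab that \<open>\<alpha> \<subseteq> \<delta>\<close> Con_refl[OF \<delta>]
    by (intro eval_trm_Con[OF \<delta> t]) (auto split: sum.split)
  have "c j \<in> carrier M" "d j \<in> carrier M" for j using Con_carrier[OF \<beta>] cd by blast+
  then show "(eval_trm M (case_sum b c) t, eval_trm M (case_sum b d) t) \<in> \<delta>"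
    using *[of c] *[of d] prem Con_sym[OF \<delta>] Con_trans[OF \<delta>] by blast
qed

text \<open>The first argument can absorb \<delta>, since \<delta> itself satisfies the condition
  there by \<open>term_condition_subset\<close>. Swapping the arguments lets both sides absorb it in
  turn; the first swap also replaces the commutator by \<delta> as the modulus.\<close>

lemma term_condition_join:
  assumes M: "is_algebra S M" and chain: "(Var 0, Var 3) \<in> (day_chain S M)\<^sup>+"
    and \<alpha>: "\<alpha> \<in> Con S M" and \<beta>: "\<beta> \<in> Con S M" and \<delta>: "\<delta> \<in> Con S M"
    and "commutator S M \<alpha> \<beta> \<subseteq> \<delta>"
  shows "term_condition S M ((\<alpha> \<union> \<delta>)\<^sup>+) ((\<beta> \<union> \<delta>)\<^sup>+) \<delta>"
proof -
  note join = trancl_Un_in_Con[OF _ \<delta>] and subset = term_condition_subset[OF \<delta> _ \<delta> order_refl]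
  note commute = term_condition_commute_mono[OF M chain _ _ _ \<delta>]
  have "term_condition S M \<beta> \<alpha> \<delta>"
    by (rule commute[OF \<alpha> \<beta> commutator_is_least(1)[OF M \<alpha> \<beta>] assms(6)
        commutator_is_least(2)[OF M \<alpha> \<beta>]])
  then have "term_condition S M ((\<beta> \<union> \<delta>)\<^sup>+) \<alpha> \<delta>"
    by (rule term_condition_trancl_Un[OF \<beta> \<delta> _ subset[OF \<alpha>]])
  then have "term_condition S M \<alpha> ((\<beta> \<union> \<delta>)\<^sup>+) \<delta>"
    by (rule commute[OF join[OF \<beta>] \<alpha> \<delta> order_refl])
  then show ?thesis
    by (rule term_condition_trancl_Un[OF \<alpha> \<delta> _ subset[OF join[OF \<beta>]]])
qed

section \<open>Congruences along surjective morphisms\<close>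

lemma morphism_oper:
  assumes "morphism S A B h" "f \<in> symbols S" "length xs = arity S f" "set xs \<subseteq> carrier A"
  shows "h (oper A f xs) = oper B f (map h xs)"
  using assms by (simp add: morphism_def)

lemma eval_morphism:
  assumes A: "is_algebra S A" and h: "morphism S A B h" and "wf_trm S t" and \<sigma>: "range \<sigma> \<subseteq> carrier A"
  shows "h (eval_trm A \<sigma> t) = eval_trm B (\<lambda>x. h (\<sigma> x)) t"
  using assms(3)
proof (induction t)
  case (App f ts)
  then have "set (map (eval_trm A \<sigma>) ts) \<subseteq> carrier A"
    using eval_trm_closed[OF A _ \<sigma>] by auto
  then have "h (eval_trm A \<sigma> (App f ts)) = oper B f (map h (map (eval_trm A \<sigma>) ts))"
    using App.prems morphism_oper[OF h, of f "map (eval_trm A \<sigma>) ts"] by simp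
  moreover have "map h (map (eval_trm A \<sigma>) ts) = map (eval_trm B (\<lambda>x. h (\<sigma> x))) ts"
    using App by simp
  ultimately show ?case by (simp only: eval_trm.simps)
qed simp

lemma eval_case_sum_morphism:
  assumes "is_algebra S A" "morphism S A B h" "wf_trm S t"
    and "\<And>i. a i \<in> carrier A" "\<And>j. c j \<in> carrier A"
  shows "h (eval_trm A (case_sum a c) t) = eval_trm B (case_sum (\<lambda>i. h (a i)) (\<lambda>j. h (c j))) t"
proof -
  have "h (eval_trm A (case_sum a c) t) = eval_trm B (\<lambda>x. h (case_sum a c x)) t"
    using assms by (intro eval_morphism) (auto split: sum.split)
  also have "(\<lambda>x. h (case_sum a c x)) = case_sum (\<lambda>i. h (a i)) (\<lambda>j. h (c j))"
    by (auto split: sum.split)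
  finally show ?thesis .
qed

lemma is_algebra_surj:
  assumes A: "is_algebra S A" and h: "morphism S A B h" and surj: "h ` carrier A = carrier B"
  shows "is_algebra S B"
  unfolding is_algebra_def
proof (intro conjI ballI allI impI)
  show "carrier B \<noteq> {}" using A surj by (auto simp: is_algebra_def)
  fix f xs assume f: "f \<in> symbols S" and "length xs = arity S f \<and> set xs \<subseteq> carrier B"
  moreover from this obtain us where us: "set us \<subseteq> carrier A" "xs = map h us"
    unfolding surj[symmetric] by (metis lists_image lists_eq_set imageE mem_Collect_eq)
  moreover have "oper A f us \<in> carrier A" using A f calculation by (simp add: is_algebra_def)
  ultimately show "oper B f xs \<in> carrier B"
    using morphism_oper[OF h f, of us] surj by (metis imageI length_map)
qed

section \<open>The correspondence of congruences along a surjection\<close>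

lemma pullback_in_Con:
  assumes A: "is_algebra S A" and h: "morphism S A B h" and \<psi>: "\<psi> \<in> Con S B"
  shows "pullback A h \<psi> \<in> Con S A"
proof (rule ConI)
  have hB: "h x \<in> carrier B" if "x \<in> carrier A" for x
    using that h by (auto simp: morphism_def)
  show "x \<in> carrier A \<and> y \<in> carrier A" if "(x, y) \<in> pullback A h \<psi>" for x y
    using that by (simp add: pullback_def)
  show "(x, x) \<in> pullback A h \<psi>" if "x \<in> carrier A" for x
    using that Con_refl[OF \<psi> hB] by (simp add: pullback_def)
  show "(y, x) \<in> pullback A h \<psi>" if "(x, y) \<in> pullback A h \<psi>" for x y
    using that Con_sym[OF \<psi>] by (simp add: pullback_def)
  show "(x, z) \<in> pullback A h \<psi>"
    if "(x, y) \<in> pullback A h \<psi>" "(y, z) \<in> pullback A h \<psi>" for x y z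
    using that Con_trans[OF \<psi>] by (auto simp: pullback_def)
  fix f xs ys
  assume f: "f \<in> symbols S" and len: "length xs = arity S f"
    and xy: "list_all2 (\<lambda>x y. (x, y) \<in> pullback A h \<psi>) xs ys"
  have len': "length ys = arity S f" using xy len by (simp add: list_all2_lengthD)
  have sub: "set xs \<subseteq> carrier A" "set ys \<subseteq> carrier A"
    using xy by (auto simp: list_all2_conv_all_nth in_set_conv_nth pullback_def)
  have "(oper B f (map h xs), oper B f (map h ys)) \<in> \<psi>"
    using xy len by (intro Con_oper[OF \<psi> f])
      (auto simp: list_all2_map1 list_all2_map2 pullback_def elim: list_all2_mono)
  then show "(oper A f xs, oper A f ys) \<in> pullback A h \<psi>"
    using A f len len' sub morphism_oper[OF h f] by (simp add: pullback_def is_algebra_def)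
qed

lemma Ker_subset_pullback: "\<psi> \<in> Con S B \<Longrightarrow> Ker A B h \<subseteq> pullback A h \<psi>"
  by (auto simp: Ker_def pullback_def intro: Con_refl)

text \<open>The kernel matters for transitivity: two preimages of the middle element are
  kernel-related, hence \<gamma>-related, so the two pairs can be joined in
  \<open>A\<close>.\<close>

lemma map_prod_in_Con:
  assumes A: "is_algebra S A" and h: "morphism S A B h" and surj: "h ` carrier A = carrier B"
    and \<gamma>: "\<gamma> \<in> Con S A" and ker: "Ker A B h \<subseteq> \<gamma>"
  shows "map_prod h h ` \<gamma> \<in> Con S B"
proof (rule ConI)
  show "x \<in> carrier B \<and> y \<in> carrier B" if "(x, y) \<in> map_prod h h ` \<gamma>" for x y
    using that Con_carrier[OF \<gamma>] surj by auto
  show "(x, x) \<in> map_prod h h ` \<gamma>" if "x \<in> carrier B" for x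
    using that Con_refl[OF \<gamma>] surj by force
  show "(y, x) \<in> map_prod h h ` \<gamma>" if "(x, y) \<in> map_prod h h ` \<gamma>" for x y
    using that Con_sym[OF \<gamma>] by force
  show "(x, z) \<in> map_prod h h ` \<gamma>"
    if xy: "(x, y) \<in> map_prod h h ` \<gamma>" and yz: "(y, z) \<in> map_prod h h ` \<gamma>" for x y z
  proof -
    obtain u v v' w where uv: "(u, v) \<in> \<gamma>" "(v', w) \<in> \<gamma>" "x = h u" "y = h v" "y = h v'" "z = h w"
      using xy yz by auto
    then have "(v, v') \<in> Ker A B h"
      using Con_carrier[OF \<gamma>] surj by (fastforce simp: Ker_def pullback_def)
    then have "(u, w) \<in> \<gamma>" using uv ker Con_trans[OF \<gamma>] by blast
    then show ?thesis using uv by force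
  qed
  fix f xs ys
  assume f: "f \<in> symbols S" and len: "length xs = arity S f"
    and xy: "list_all2 (\<lambda>x y. (x, y) \<in> map_prod h h ` \<gamma>) xs ys"
  \<comment> \<open>Preimages are chosen pair by pair, so that the lifted lists are themselves
    \<gamma>-related.\<close>
  from xy have "\<exists>us vs. xs = map h us \<and> ys = map h vs \<and> list_all2 (\<lambda>x y. (x, y) \<in> \<gamma>) us vs"
  proof (induction rule: list_all2_induct)
    case (Cons x xs y ys)
    then obtain u v us vs where "(u, v) \<in> \<gamma>" "x = h u" "y = h v" "xs = map h us" "ys = map h vs"
      "list_all2 (\<lambda>x y. (x, y) \<in> \<gamma>) us vs"
      by auto
    then show ?case by (intro exI[of _ "u # us"] exI[of _ "v # vs"]) simp
  qed simp
  then obtain us vs where uv: "xs = map h us" "ys = map h vs"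
    "list_all2 (\<lambda>x y. (x, y) \<in> \<gamma>) us vs"
    by blast
  then have "(oper A f us, oper A f vs) \<in> \<gamma>" using len by (intro Con_oper[OF \<gamma> f]) auto
  then have "(h (oper A f us), h (oper A f vs)) \<in> map_prod h h ` \<gamma>" by force
  moreover have "list_all2 (\<lambda>x y. x \<in> carrier A \<and> y \<in> carrier A) us vs"
    using uv(3) by (rule list_all2_mono) (use Con_carrier[OF \<gamma>] in blast)
  then have "set us \<subseteq> carrier A" "set vs \<subseteq> carrier A" "length us = arity S f" "length vs = arity S f"
    using uv len by (auto simp: list_all2_conv_all_nth in_set_conv_nth)
  ultimately show "(oper B f xs, oper B f ys) \<in> map_prod h h ` \<gamma>"
    using morphism_oper[OF h f] uv(1,2) by simp
qed

text \<open>One half of the correspondence: a pair with the same image as a pair of \<gamma> differs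
  from it only by kernel steps, which \<gamma> contains.\<close>

lemma pullback_map_prod:
  assumes h: "h ` carrier A \<subseteq> carrier B" and \<gamma>: "\<gamma> \<in> Con S A" and ker: "Ker A B h \<subseteq> \<gamma>"
  shows "pullback A h (map_prod h h ` \<gamma>) = \<gamma>"
proof
  show "\<gamma> \<subseteq> pullback A h (map_prod h h ` \<gamma>)"
    using Con_carrier[OF \<gamma>] by (auto simp: pullback_def)
  show "pullback A h (map_prod h h ` \<gamma>) \<subseteq> \<gamma>"
  proof (rule subrelI)
    fix x y assume "(x, y) \<in> pullback A h (map_prod h h ` \<gamma>)"
    then obtain u v where uv: "x \<in> carrier A" "y \<in> carrier A" "(u, v) \<in> \<gamma>" "h x = h u" "h y = h v"
      by (auto simp: pullback_def)
    then have "(x, u) \<in> Ker A B h" "(v, y) \<in> Ker A B h"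
      using Con_carrier[OF \<gamma> uv(3)] h by (fastforce simp: Ker_def pullback_def)+
    then show "(x, y) \<in> \<gamma>" using uv(3) ker Con_trans[OF \<gamma>] by blast
  qed
qed

text \<open>The other half: by surjectivity every pair of \<psi> has a preimage, so pulling back is
  an order embedding and in particular injective.\<close>

lemma pullback_subset_iff:
  assumes "h ` carrier A = carrier B" and "\<psi> \<subseteq> carrier B \<times> carrier B"
  shows "pullback A h \<psi> \<subseteq> pullback A h \<chi> \<longleftrightarrow> \<psi> \<subseteq> \<chi>"
proof
  assume sub: "pullback A h \<psi> \<subseteq> pullback A h \<chi>"
  show "\<psi> \<subseteq> \<chi>"
  proof (rule subrelI)
    fix x y assume xy: "(x, y) \<in> \<psi>"
    then obtain u v where "u \<in> carrier A" "v \<in> carrier A" "x = h u" "y = h v"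
      using assms by blast
    then show "(x, y) \<in> \<chi>" using sub xy by (auto simp: pullback_def)
  qed
qed (auto simp: pullback_def)

section \<open>The term condition and primality along a surjection\<close>

lemma Con_subset: "\<theta> \<in> Con S M \<Longrightarrow> \<theta> \<subseteq> carrier M \<times> carrier M"
  by (auto dest: Con_carrier)

text \<open>A morphism commutes with term evaluation, so it sends a matrix in \<open>A\<close> to a
  matrix of the same term in \<open>B\<close>.\<close>

lemma term_condition_pullback:
  fixes S :: "'f signature" and A :: "('f, 'a) algebra" and B :: "('f, 'b) algebra"
  assumes A: "is_algebra S A" and h: "morphism S A B h" and tc: "term_condition S B \<alpha> \<beta> \<delta>"
  shows "term_condition S A (pullback A h \<alpha>) (pullback A h \<beta>) (pullback A h \<delta>)"
  unfolding term_condition_def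
proof (intro allI impI, elim conjE)
  fix t :: "('f, nat + nat) trm" and a b c d :: "nat \<Rightarrow> 'a"
  assume t: "wf_trm S t" and ab: "\<forall>i. (a i, b i) \<in> pullback A h \<alpha>"
    and cd: "\<forall>j. (c j, d j) \<in> pullback A h \<beta>"
    and prem: "(eval_trm A (case_sum a c) t, eval_trm A (case_sum a d) t) \<in> pullback A h \<delta>"
  have car: "a i \<in> carrier A" "b i \<in> carrier A" "c i \<in> carrier A" "d i \<in> carrier A" for i
    using ab cd by (auto simp: pullback_def)
  note eval = eval_case_sum_morphism[OF A h t]
  have "(h (eval_trm A (case_sum b c) t), h (eval_trm A (case_sum b d) t)) \<in> \<delta>"
    unfolding eval[of b c, OF car(2,3)] eval[of b d, OF car(2,4)]
    by (rule term_conditionD[OF tc t, where a = "\<lambda>i. h (a i)"])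
      (use ab cd prem in \<open>auto simp: pullback_def eval[of a c, OF car(1,3)] eval[of a d, OF car(1,4)]\<close>)
  then show "(eval_trm A (case_sum b c) t, eval_trm A (case_sum b d) t) \<in> pullback A h \<delta>"
    using eval_case_sum_closed[OF A t] car by (simp add: pullback_def)
qed

lemma term_condition_pullbackD:
  fixes S :: "'f signature" and A :: "('f, 'a) algebra" and B :: "('f, 'b) algebra"
  assumes A: "is_algebra S A" and h: "morphism S A B h" and surj: "h ` carrier A = carrier B"
    and sub: "\<alpha> \<subseteq> carrier B \<times> carrier B" "\<beta> \<subseteq> carrier B \<times> carrier B"
    and tc: "term_condition S A (pullback A h \<alpha>) (pullback A h \<beta>) (pullback A h \<delta>)"
  shows "term_condition S B \<alpha> \<beta> \<delta>"
  unfolding term_condition_def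
proof (intro allI impI, elim conjE)
  fix t :: "('f, nat + nat) trm" and a b c d :: "nat \<Rightarrow> 'b"
  assume t: "wf_trm S t" and ab: "\<forall>i. (a i, b i) \<in> \<alpha>" and cd: "\<forall>j. (c j, d j) \<in> \<beta>"
    and prem: "(eval_trm B (case_sum a c) t, eval_trm B (case_sum a d) t) \<in> \<delta>"
  \<comment> \<open>A choice of preimages lifts the matrix to \<open>A\<close>. It need not respect
    the operations: \<open>h\<close> maps the lifted values back to the given ones.\<close>
  define g where "g = inv_into (carrier A) h"
  have g: "g x \<in> carrier A" "h (g x) = x" if "x \<in> carrier B" for x
    using that surj unfolding g_def by (auto intro: inv_into_into f_inv_into_f)
  have "a i \<in> carrier B" "b i \<in> carrier B" "c i \<in> carrier B" "d i \<in> carrier B" for i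
    using ab cd sub by blast+
  note car = g(1)[OF this(1)] g(1)[OF this(2)] g(1)[OF this(3)] g(1)[OF this(4)]
    and hg = g(2)[OF this(1)] g(2)[OF this(2)] g(2)[OF this(3)] g(2)[OF this(4)]
  have eval: "h (eval_trm A (case_sum (\<lambda>i. g (u i)) (\<lambda>j. g (v j))) t) = eval_trm B (case_sum u v) t"
    if "\<And>i. g (u i) \<in> carrier A" "\<And>i. g (v i) \<in> carrier A" "\<And>i. h (g (u i)) = u i"
      "\<And>i. h (g (v i)) = v i" for u v :: "nat \<Rightarrow> 'b"
    using eval_case_sum_morphism[OF A h t, of "\<lambda>i. g (u i)" "\<lambda>j. g (v j)"] that by simp
  have "(eval_trm A (case_sum (\<lambda>i. g (b i)) (\<lambda>j. g (c j))) t,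
      eval_trm A (case_sum (\<lambda>i. g (b i)) (\<lambda>j. g (d j))) t) \<in> pullback A h \<delta>"
    by (rule term_conditionD[OF tc t, where a = "\<lambda>i. g (a i)"])
      (use ab cd prem car hg eval_case_sum_closed[OF A t] in \<open>auto simp: pullback_def eval\<close>)
  then show "(eval_trm B (case_sum b c) t, eval_trm B (case_sum b d) t) \<in> \<delta>"
    using car hg by (simp add: pullback_def eval)
qed

lemma Spec_Con: "\<theta> \<in> Spec S M \<Longrightarrow> \<theta> \<in> Con S M"
  by (simp add: Spec_def prime_congruence_def)

text \<open>From \<open>A\<close> to \<open>B\<close>: the pullback of a commutator satisfies the
  term condition for the pulled back congruences, hence contains their commutator. From
  \<open>B\<close> to \<open>A\<close>: joining \<alpha> and \<beta> with the pullback of \<psi>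
  brings them above the kernel, so they come from congruences of \<open>B\<close>;
  \<open>term_condition_join\<close>, where the Day chain enters, gives the term condition for the
  joins, and it descends to \<open>B\<close>.\<close>

lemma Spec_pullback_iff:
  assumes A: "is_algebra S A" and chain: "(Var 0, Var 3) \<in> (day_chain S A)\<^sup>+"
    and h: "morphism S A B h" and surj: "h ` carrier A = carrier B" and \<psi>: "\<psi> \<in> Con S B"
  shows "pullback A h \<psi> \<in> Spec S A \<longleftrightarrow> \<psi> \<in> Spec S B"
proof -
  let ?pb = "pullback A h"
  have B: "is_algebra S B" using is_algebra_surj[OF A h surj] .
  have pb: "?pb \<theta> \<in> Con S A" if "\<theta> \<in> Con S B" for \<theta> using pullback_in_Con[OF A h that] .
  have le: "?pb \<theta> \<subseteq> ?pb \<chi> \<longleftrightarrow> \<theta> \<subseteq> \<chi>" if "\<theta> \<in> Con S B" for \<theta> \<chi>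
    using pullback_subset_iff[OF surj Con_subset[OF that]] .
  have full: "?pb (carrier B \<times> carrier B) = carrier A \<times> carrier A"
    using surj by (auto simp: pullback_def)
  \<comment> \<open>Pulling back is an order embedding that takes the full relation to the full
    relation.\<close>
  have proper: "?pb \<psi> = carrier A \<times> carrier A \<longleftrightarrow> \<psi> = carrier B \<times> carrier B"
    using le[OF \<psi>, of "carrier B \<times> carrier B"] le[OF full_in_Con[OF B], of \<psi>]
    unfolding full by blast
  show ?thesis
  proof
    assume prime: "?pb \<psi> \<in> Spec S A"
    have "\<alpha> \<subseteq> \<psi> \<or> \<beta> \<subseteq> \<psi>"
      if \<alpha>: "\<alpha> \<in> Con S B" and \<beta>: "\<beta> \<in> Con S B" and c: "commutator S B \<alpha> \<beta> \<subseteq> \<psi>" for \<alpha> \<beta>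
    proof -
      have "commutator S A (?pb \<alpha>) (?pb \<beta>) \<subseteq> ?pb (commutator S B \<alpha> \<beta>)"
        using commutator_is_least[OF B \<alpha> \<beta>]
        by (intro commutator_is_least(3)[OF A pb[OF \<alpha>] pb[OF \<beta>]] pb term_condition_pullback[OF A h])
      also have "\<dots> \<subseteq> ?pb \<psi>" using c by (auto simp: pullback_def)
      finally have "?pb \<alpha> \<subseteq> ?pb \<psi> \<or> ?pb \<beta> \<subseteq> ?pb \<psi>"
        using prime pb[OF \<alpha>] pb[OF \<beta>] by (simp add: Spec_def prime_congruence_def)
      then show ?thesis using le \<alpha> \<beta> by simp
    qed
    then show "\<psi> \<in> Spec S B"
      using prime \<psi> proper by (simp add: Spec_def prime_congruence_def)
  next
    assume prime: "\<psi> \<in> Spec S B"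
    have "\<alpha> \<subseteq> ?pb \<psi> \<or> \<beta> \<subseteq> ?pb \<psi>"
      if \<alpha>: "\<alpha> \<in> Con S A" and \<beta>: "\<beta> \<in> Con S A" and c: "commutator S A \<alpha> \<beta> \<subseteq> ?pb \<psi>" for \<alpha> \<beta>
    proof -
      have lift: "\<exists>\<theta>'\<in>Con S B. ?pb \<theta>' = (\<theta> \<union> ?pb \<psi>)\<^sup>+" if \<theta>: "\<theta> \<in> Con S A" for \<theta>
      proof -
        have join: "(\<theta> \<union> ?pb \<psi>)\<^sup>+ \<in> Con S A" by (rule trancl_Un_in_Con[OF \<theta> pb[OF \<psi>]])
        have ker: "Ker A B h \<subseteq> (\<theta> \<union> ?pb \<psi>)\<^sup>+" using Ker_subset_pullback[OF \<psi>] by fast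
        show ?thesis
          using map_prod_in_Con[OF A h surj join ker] pullback_map_prod[OF _ join ker] surj by blast
      qed
      obtain \<alpha>' where \<alpha>': "\<alpha>' \<in> Con S B" "?pb \<alpha>' = (\<alpha> \<union> ?pb \<psi>)\<^sup>+" using lift[OF \<alpha>] by blast
      obtain \<beta>' where \<beta>': "\<beta>' \<in> Con S B" "?pb \<beta>' = (\<beta> \<union> ?pb \<psi>)\<^sup>+" using lift[OF \<beta>] by blast
      have "term_condition S A (?pb \<alpha>') (?pb \<beta>') (?pb \<psi>)"
        unfolding \<alpha>'(2) \<beta>'(2) by (rule term_condition_join[OF A chain \<alpha> \<beta> pb[OF \<psi>] c])
      then have "term_condition S B \<alpha>' \<beta>' \<psi>"
        by (rule term_condition_pullbackD[OF A h surj Con_subset[OF \<alpha>'(1)] Con_subset[OF \<beta>'(1)]])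
      then have "commutator S B \<alpha>' \<beta>' \<subseteq> \<psi>"
        by (rule commutator_is_least(3)[OF B \<alpha>'(1) \<beta>'(1) \<psi>])
      then have "\<alpha>' \<subseteq> \<psi> \<or> \<beta>' \<subseteq> \<psi>"
        using prime \<alpha>'(1) \<beta>'(1) by (simp add: Spec_def prime_congruence_def)
      then have "(\<alpha> \<union> ?pb \<psi>)\<^sup>+ \<subseteq> ?pb \<psi> \<or> (\<beta> \<union> ?pb \<psi>)\<^sup>+ \<subseteq> ?pb \<psi>"
        using le \<alpha>' \<beta>' by metis
      then show ?thesis by (meson le_supE r_into_trancl' subrelI subset_iff)
    qed
    then show "?pb \<psi> \<in> Spec S A"
      using prime pb[OF \<psi>] proper by (simp add: Spec_def prime_congruence_def)
  qed
qed

section \<open>Transfer along the factorisation of \<open>h\<close> through its image\<close>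

theorem proposition4p15:
  fixes S :: "'f signature"
    and E :: "(('f, nat) trm \<times> ('f, nat) trm) set"
    and M :: "('f, 'a) algebra" and N :: "('f, 'b) algebra"
    and h :: "'a \<Rightarrow> 'b"
  assumes "wf_identities S E"
    and "congruence_modular TYPE('a + 'b + ('f, nat) trm) S E"
    and "M \<in> equational_class S E" and "N \<in> equational_class S E"
    and "morphism S M N h"
  shows "(admissible S M N h \<longleftrightarrow> admissible S (image_algebra M N h) N (\<lambda>x. x)) \<and>
    (admissible S M N h \<longrightarrow> (GU S M N h \<longleftrightarrow> GU S (image_algebra M N h) N (\<lambda>x. x))) \<and>
    (admissible S M N h \<longrightarrow> (LO S M N h \<longleftrightarrow> LO S (image_algebra M N h) N (\<lambda>x. x)))"
proof -
  define P where "P = image_algebra M N h"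
  \<comment> \<open>The third summand of the type in the modularity hypothesis makes room for the
    free algebra on countably many generators, whose elements are represented by terms.\<close>
  let ?e = "\<lambda>t. Inr (Inr t) :: 'a + 'b + ('f, nat) trm"
  \<comment> \<open>\<open>pullback\<close> mentions no codomain, so \<open>?p\<close> serves both
    for \<open>h\<close> into \<open>N\<close> and for the surjection onto \<open>P\<close>.\<close>
  let ?p = "pullback M h" and ?i = "pullback P (\<lambda>x. x)"
  have M: "is_algebra S M" using assms(3) by (simp add: equational_class_def)
  have "inj ?e" by (rule injI) simp
  then have chain: "(Var 0, Var 3) \<in> (day_chain S M)\<^sup>+"
    using assms(2) free_algebra_in_equational_class[OF _ assms(1,3), of ?e]
    unfolding congruence_modular_def by (intro day_terms) blast+
  have car: "carrier P = h ` carrier M" "oper P = oper N" by (simp_all add: P_def image_algebra_def)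
  have h: "morphism S M P h" using assms(5) by (simp add: morphism_def car)
  have surj: "h ` carrier M = carrier P" by (simp add: car)
  have P: "is_algebra S P" by (rule is_algebra_surj[OF M h surj])
  have i: "morphism S P N (\<lambda>x. x)" using assms(5) by (simp add: morphism_def car)
  have spec: "?p \<chi> \<in> Spec S M \<longleftrightarrow> \<chi> \<in> Spec S P" if "\<chi> \<in> Con S P" for \<chi>
    by (rule Spec_pullback_iff[OF M chain h surj that])
  have le: "?p \<chi> \<subseteq> ?p \<chi>' \<longleftrightarrow> \<chi> \<subseteq> \<chi>'" if "\<chi> \<in> Con S P" for \<chi> \<chi>'
    by (rule pullback_subset_iff[OF surj Con_subset[OF that]])
  then have inj: "?p \<chi> = ?p \<chi>' \<longleftrightarrow> \<chi> = \<chi>'" if "\<chi> \<in> Con S P" "\<chi>' \<in> Con S P" for \<chi> \<chi>'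
    using that by (metis subset_antisym order_refl)
  have ker: "Ker M P h = Ker M N h"
    using assms(5) by (auto simp: Ker_def pullback_def car morphism_def)
  have lift: "\<exists>\<chi>\<in>Con S P. ?p \<chi> = \<gamma>" if "\<gamma> \<in> Con S M" "Ker M N h \<subseteq> \<gamma>" for \<gamma>
    using map_prod_in_Con[OF M h surj that(1)] pullback_map_prod[OF _ that(1), of h P] surj that(2)
    unfolding ker by blast
  have ip: "?i \<psi> \<in> Con S P" if "\<psi> \<in> Spec S N" for \<psi>
    by (rule pullback_in_Con[OF P i Spec_Con[OF that]])
  \<comment> \<open>Pulling back along \<open>h\<close> is pulling back along the inclusion and then
    along the surjection. With \<open>spec\<close>, primality of \<open>?p \<psi>\<close> thus
    becomes primality of \<open>?i \<psi>\<close>.\<close>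
  have comp: "?p \<psi> = ?p (?i \<psi>)" for \<psi> by (auto simp: pullback_def car)
  have adm: "admissible S M N h \<longleftrightarrow> admissible S P N (\<lambda>x. x)"
    unfolding admissible_def using spec ip comp by metis
  have lift_spec: "\<exists>\<chi>\<in>Spec S P. ?p \<chi> = \<gamma>" if "\<gamma> \<in> Spec S M" "Ker M N h \<subseteq> \<gamma>" for \<gamma>
    using lift[OF Spec_Con[OF that(1)] that(2)] spec that(1) by blast
  have spec': "?p \<chi> \<in> Spec S M" if "\<chi> \<in> Spec S P" for \<chi>
    using spec[OF Spec_Con[OF that]] that by simp
  have ker_le: "Ker M N h \<subseteq> ?p \<chi>" if "\<chi> \<in> Spec S P" for \<chi>
    using Ker_subset_pullback[OF Spec_Con[OF that], of M h] by (simp add: ker)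
  \<comment> \<open>As \<open>?p\<close> is injective on congruences of \<open>P\<close>, conditions
    on the inclusion can be rewritten as conditions on \<open>?p\<close>, the form they have for
    \<open>h\<close>.\<close>
  have eq: "?p \<psi> = ?p \<chi> \<longleftrightarrow> ?i \<psi> = \<chi>" if "\<psi> \<in> Spec S N" "\<chi> \<in> Spec S P" for \<psi> \<chi>
    unfolding comp[of \<psi>] by (rule inj[OF ip[OF that(1)] Spec_Con[OF that(2)]])
  have lo: "LO S M N h \<longleftrightarrow> LO S P N (\<lambda>x. x)"
  proof -
    \<comment> \<open>The kernel of the inclusion is equality, so LO for it concerns every prime of
      \<open>P\<close>.\<close>
    have "Ker P N (\<lambda>x. x) \<subseteq> \<chi>" if "\<chi> \<in> Spec S P" for \<chi>
      using Con_refl[OF Spec_Con[OF that]] by (auto simp: Ker_def pullback_def)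
    then have "LO S P N (\<lambda>x. x) \<longleftrightarrow> (\<forall>\<chi>\<in>Spec S P. \<exists>\<psi>\<in>Spec S N. ?p \<psi> = ?p \<chi>)"
      by (simp add: LO_def eq cong: ball_cong bex_cong)
    also have "\<dots> \<longleftrightarrow> LO S M N h"
      unfolding LO_def
    proof (intro iffI ballI impI)
      fix \<phi> assume *: "\<forall>\<chi>\<in>Spec S P. \<exists>\<psi>\<in>Spec S N. ?p \<psi> = ?p \<chi>"
        and "\<phi> \<in> Spec S M" "Ker M N h \<subseteq> \<phi>"
      then obtain \<chi> where "\<chi> \<in> Spec S P" "?p \<chi> = \<phi>" using lift_spec by blast
      then show "\<exists>\<psi>\<in>Spec S N. ?p \<psi> = \<phi>" using * by blast
    next
      fix \<chi> assume "\<forall>\<phi>\<in>Spec S M. Ker M N h \<subseteq> \<phi> \<longrightarrow> (\<exists>\<psi>\<in>Spec S N. ?p \<psi> = \<phi>)"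
        and "\<chi> \<in> Spec S P"
      then show "\<exists>\<psi>\<in>Spec S N. ?p \<psi> = ?p \<chi>" using spec' ker_le by blast
    qed
    finally show ?thesis by simp
  qed
  have gu: "GU S M N h \<longleftrightarrow> GU S P N (\<lambda>x. x)"
  proof -
    have "GU S P N (\<lambda>x. x) \<longleftrightarrow> (\<forall>\<phi>\<in>Spec S P. \<forall>\<chi>\<in>Spec S P. \<forall>\<psi>\<in>Spec S N.
        ?p \<phi> \<subseteq> ?p \<chi> \<and> ?p \<psi> = ?p \<phi> \<longrightarrow> (\<exists>\<psi>'\<in>Spec S N. \<psi> \<subseteq> \<psi>' \<and> ?p \<psi>' = ?p \<chi>))"
      by (simp add: GU_def eq le[OF Spec_Con] cong: ball_cong bex_cong)
    also have "\<dots> \<longleftrightarrow> GU S M N h"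
    proof
      assume *: "\<forall>\<phi>\<in>Spec S P. \<forall>\<chi>\<in>Spec S P. \<forall>\<psi>\<in>Spec S N.
        ?p \<phi> \<subseteq> ?p \<chi> \<and> ?p \<psi> = ?p \<phi> \<longrightarrow> (\<exists>\<psi>'\<in>Spec S N. \<psi> \<subseteq> \<psi>' \<and> ?p \<psi>' = ?p \<chi>)"
      show "GU S M N h"
        unfolding GU_def
      proof (intro ballI impI, elim conjE)
        fix \<phi> \<chi> \<psi>
        assume "\<phi> \<in> Spec S M" "\<chi> \<in> Spec S M" and \<psi>: "\<psi> \<in> Spec S N" and sub: "\<phi> \<subseteq> \<chi>" "?p \<psi> = \<phi>"
        \<comment> \<open>Being a pullback, \<phi> contains the kernel, and then so does \<chi>;
          both therefore come from primes of \<open>P\<close>.\<close>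
        moreover have "Ker M N h \<subseteq> \<phi>"
          using Ker_subset_pullback[OF Spec_Con[OF \<psi>], of M h] sub(2) by simp
        ultimately obtain \<phi>' \<chi>' where "\<phi>' \<in> Spec S P" "?p \<phi>' = \<phi>" "\<chi>' \<in> Spec S P" "?p \<chi>' = \<chi>"
          using lift_spec by (metis order_trans)
        then show "\<exists>\<psi>'\<in>Spec S N. \<psi> \<subseteq> \<psi>' \<and> ?p \<psi>' = \<chi>" using * \<psi> sub by blast
      qed
    next
      assume "GU S M N h"
      then show "\<forall>\<phi>\<in>Spec S P. \<forall>\<chi>\<in>Spec S P. \<forall>\<psi>\<in>Spec S N.
        ?p \<phi> \<subseteq> ?p \<chi> \<and> ?p \<psi> = ?p \<phi> \<longrightarrow> (\<exists>\<psi>'\<in>Spec S N. \<psi> \<subseteq> \<psi>' \<and> ?p \<psi>' = ?p \<chi>)"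
        unfolding GU_def using spec' by blast
    qed
    finally show ?thesis by simp
  qed
  show ?thesis using adm gu lo unfolding P_def by blast
qed

end
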